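(* Let $r\in(0,1)$, let $\mathfrak{p}^{(\infty)}\in\mathbb{V}_h(\Sigma)$ be the unique solution of $(\mathrm{Id}+\Pi S_h)\mathfrak{p}^{(\infty)}=\mathfrak{f}$, and let $$\gamma_h:=\inf_{\mathfrak{w}\in\mathbb{V}_h(\Sigma)\setminus\{0\}}\frac{\|(\mathrm{Id}+\Pi S_h)\mathfrak{w}\|_{t_h}}{\|\mathfrak{w}\|_{t_h}}.$$ Let $(u^{(n)},\mathfrak{p}^{(n)})\in\mathbb{V}_h(\Omega)\times\mathbb{V}_h(\Sigma)$, $n\ge0$, be the iterates of the relaxed Richardson algorithm: (i) $a(u^{(n)},v)-i\,t_h(u^{(n)}|_\Sigma,v|_\Sigma)=t_h(\mathfrak{p}^{(n)},v|_\Sigma)+\ell(v)$ for all $v\in\mathbb{V}_h(\Omega)$, $n\ge0$; (ii) $\mathfrak{p}^{(n)}=(1-r)\mathfrak{p}^{(n-1)}-r\,\Pi(\mathfrak{p}^{(n-1)}+2i\,u^{(n-1)}|_\Sigma)$, $n\ge1$, with $\mathfrak{p}^{(0)}\in\mathbb{V}_h(\Sigma)$, $\mathfrak{p}^{(0)}\neq\mathfrak{p}^{(\infty)}$, given. Then for all $n\ge0$ $$\frac{\|\mathfrak{p}^{(n)}-\mathfrak{p}^{(\infty)}\|_{t_h}}{\|\mathfrak{p}^{(0)}-\mathfrak{p}^{(\infty)}\|_{t_h}}\le\big(1-r(1-r)\gamma_h^2\big)^{n/2}.$$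
   Context: Coefficients. Let $d\in\{1,2,3\}$, $\Omega\subset\mathbb{R}^d$ a bounded polygonal/polyhedral domain, $\kappa:\Omega\to\mathbb{C}$ and $\mu:\Omega\to(0,+\infty)$ measurable with $\mathrm{Re}\,\kappa\ge0$, $\mathrm{Im}\,\kappa\ge0$ in $\Omega$, $\kappa_\infty:=\max(1,\|\kappa\|_{L^\infty(\Omega)})<\infty$, $\|\mu\|_{L^\infty(\Omega)}+\|\mu^{-1}\|_{L^\infty(\Omega)}<\infty$; $\kappa$ has measurable boundary values on $\partial\Omega$ with the same signs and $|\kappa|\le\kappa_\infty$. Let $f\in L^2(\Omega)$, $g\in L^2(\partial\Omega)$. Norm: $\|v\|_{H^1(\omega)}^2:=\|\nabla v\|_{L^2(\omega)}^2+\kappa_\infty^2\|v\|_{L^2(\omega)}^2$. Mesh and spaces. $\mathcal{T}_h(\Omega)$ is a regular simplicial triangulation of $\Omega$; for fixed $k\ge1$, $V_h(\Omega)$ is the space of continuous complex-valued functions on $\overline\Omega$ that are polynomials of degree $\le k$ on each cell. $\overline\Omega=\cup_{j=1}^J\overline{\Omega}_j^h$ with pairwise disjoint polyhedral $\Omega_j^h$ whose closures are unions of mesh cells; $\Gamma_j^h:=\partial\Omega_j^h$, $\Sigma:=\cup_j\Gamma_j^h$ (cross-points allowed). $V_h(\Omega_j^h)$, $V_h(\Gamma_j^h)$ are the spaces of restrictions of functions of $V_h(\Omega)$. $\mathbb{V}_h(\Omega):=\{u\in L^2(\Omega): u|_{\Omega_j^h}\in V_h(\Omega_j^h)\ \forall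 j\}$; for $v\in\mathbb{V}_h(\Omega)$, $v|_\Sigma:=(v|_{\Gamma_1^h},\dots,v|_{\Gamma_J^h})$ with traces from the interior of $\Omega_j^h$. $\mathbb{V}_h(\Sigma):=V_h(\Gamma_1^h)\times\cdots\times V_h(\Gamma_J^h)$ and $V_h(\Sigma):=\{v|_\Sigma: v\in V_h(\Omega)\}$. Forms. On $\mathbb{V}_h(\Omega)$, with interior traces on $\partial\Omega_j^h\cap\partial\Omega$, $a(u,v):=\sum_{j=1}^J\big(\int_{\Omega_j^h}\mu\nabla u\cdot\nabla\overline v-\kappa^2u\overline v\,dx-i\int_{\partial\Omega_j^h\cap\partial\Omega}\kappa u\overline v\,d\sigma\big)$ and $\ell(v):=\sum_{j=1}^J\big(\int_{\Omega_j^h}f\overline v\,dx+\int_{\partial\Omega_j^h\cap\partial\Omega}g\overline v\,d\sigma\big)$. Assumptions. $\alpha_h:=\inf_{u\in V_h(\Omega)\setminus\{0\}}\sup_{v\in V_h(\Omega)\setminus\{0\}}\frac{|a(u,v)|}{\|u\|_{H^1(\Omega)}\|v\|_{H^1(\Omega)}}>0$; $t_h(\cdot,\cdot)$ (the impedance) is a scalar product on $\mathbb{V}_h(\Sigma)$ (linear in the first, antilinear in the second argument), $\|\mathfrak{w}\|_{t_h}:=\sqrt{t_h(\mathfrak{w},\mathfrak{w})}$. Operators. $\Pi:\mathbb{V}_h(\Sigma)\to\mathbb{V}_h(\Sigma)$ is such that $(\mathrm{Id}+\Pi)/2$ is the $t_h$-orthogonal projector onto $V_h(\Sigma)$. $S_h(\mathfrak{p}):=\mathfrak{p}+2i\,w|_\Sigma$,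 where $w\in\mathbb{V}_h(\Omega)$ is the unique solution of $a(w,v)-i\,t_h(w|_\Sigma,v|_\Sigma)=t_h(\mathfrak{p},v|_\Sigma)$ for all $v\in\mathbb{V}_h(\Omega)$. $\mathfrak{f}:=-2i\,\Pi(u_\star|_\Sigma)$, where $u_\star\in\mathbb{V}_h(\Omega)$ is the unique solution of $a(u_\star,v)-i\,t_h(u_\star|_\Sigma,v|_\Sigma)=\ell(v)$ for all $v\in\mathbb{V}_h(\Omega)$. *)

theory Defs
  imports "HOL-Probability.Probability" "HOL-Library.Function_Algebras"
begin

section \<open>Domain, mesh and coefficients\<close>

text \<open>A polyhedral open set is the interior of a finite union of polytopes (no cracks, no isolated
  missing points).  It is not required to be connected; a domain is.\<close>

definition polyhedral_open :: "(real^'n) set \<Rightarrow> bool" where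
  "polyhedral_open D \<longleftrightarrow> open D \<and> bounded D \<and> D \<noteq> {} \<and> interior (closure D) = D \<and>
     (\<exists>P. finite P \<and> (\<forall>Q\<in>P. polytope Q) \<and> closure D = \<Union>P)"

definition polyhedral_domain :: "(real^'n) set \<Rightarrow> bool" where
  "polyhedral_domain \<Omega> \<longleftrightarrow> polyhedral_open \<Omega> \<and> connected \<Omega>"

definition simplicial_mesh :: "(real^'n) set \<Rightarrow> (real^'n) set set \<Rightarrow> bool" where
  "simplicial_mesh \<Omega> \<T> \<longleftrightarrow>
     triangulation \<T> \<and> (\<forall>K\<in>\<T>. int CARD('n) simplex K) \<and> \<Union>\<T> = closure \<Omega>"

definition mesh_partition :: "(real^'n) set \<Rightarrow> (real^'n) set set \<Rightarrow> ('j::finite \<Rightarrow> (real^'n) set) \<Rightarrow> bool"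
  where "mesh_partition \<Omega> \<T> D \<longleftrightarrow>
     (\<forall>j. polyhedral_open (D j)) \<and> (\<forall>i j. i \<noteq> j \<longrightarrow> D i \<inter> D j = {}) \<and>
     (\<forall>j. \<exists>C\<subseteq>\<T>. closure (D j) = \<Union>C) \<and> closure \<Omega> = (\<Union>j. closure (D j))"

definition Linf_norm :: "(real^'n) set \<Rightarrow> (real^'n \<Rightarrow> 'b::{real_normed_vector}) \<Rightarrow> ereal" where
  "Linf_norm S h = esssup (lebesgue_on S) (\<lambda>x. ereal (norm (h x)))"

definition kappa_inf :: "(real^'n) set \<Rightarrow> (real^'n \<Rightarrow> complex) \<Rightarrow> real" where
  "kappa_inf \<Omega> \<kappa> = max 1 (real_of_ereal (Linf_norm \<Omega> \<kappa>))"

definition L2_fun :: "(real^'n) measure \<Rightarrow> (real^'n \<Rightarrow> complex) \<Rightarrow> bool" where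
  "L2_fun M h \<longleftrightarrow> h \<in> borel_measurable M \<and> integrable M (\<lambda>x. (cmod (h x))\<^sup>2)"


section \<open>Surface measure\<close>

text \<open>The boundary of \<open>\<Omega>\<close> is the union of the mesh facets that it contains, and these overlap only
  in sets of dimension at most \<open>d - 2\<close>.  The surface measure is the sum over these facets \<open>F\<close> of the
  \<open>(d-1)\<close>-dimensional Lebesgue measure on \<open>F\<close>.  The latter is expressed without choosing coordinates
  on \<open>F\<close>: the area of a subset of a hyperplane is the volume of the right prism of height 1 on
  that subset.  For \<open>d = 1\<close> the facets are points, the prisms are intervals of length 1, and one
  obtains the counting measure on the boundary points.\<close>

definition facet_normal :: "(real^'n) set \<Rightarrow> real^'n" where
  "facet_normal F = (SOME \<nu>. norm \<nu> = 1 \<and> (\<forall>x\<in>F. \<forall>y\<in>F. \<nu> \<bullet> (x - y) = 0))"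

definition prism :: "(real^'n) set \<Rightarrow> (real^'n) set \<Rightarrow> (real^'n) set" where
  "prism F A = {x + s *\<^sub>R facet_normal F | x s. x \<in> A \<inter> F \<and> 0 \<le> s \<and> s \<le> 1}"

definition boundary_facets :: "(real^'n) set \<Rightarrow> (real^'n) set set \<Rightarrow> (real^'n) set set" where
  "boundary_facets \<Omega> \<T> = {F. (\<exists>K\<in>\<T>. F facet_of K) \<and> F \<subseteq> frontier \<Omega>}"

definition borel_surface_measure :: "(real^'n) set \<Rightarrow> (real^'n) set set \<Rightarrow> (real^'n) measure" where
  "borel_surface_measure \<Omega> \<T> =
     measure_of UNIV (sets borel) (\<lambda>A. \<Sum>F\<in>boundary_facets \<Omega> \<T>. emeasure lborel (prism F A))"

definition surface_measure :: "(real^'n) set \<Rightarrow> (real^'n) set set \<Rightarrow> (real^'n) measure" where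
  "surface_measure \<Omega> \<T> = completion (borel_surface_measure \<Omega> \<T>)"

text \<open>\<open>measure_of\<close> silently yields the null measure if the given set function is not a measure; the
  lemma \<open>emeasure_borel_surface_measure\<close> below shows that this does not happen here.\<close>

lemma facet_normal:
  fixes F K :: "(real^'n) set"
  assumes "F facet_of K"
  shows "norm (facet_normal F) = 1 \<and> (\<forall>x\<in>F. \<forall>y\<in>F. facet_normal F \<bullet> (x - y) = 0)"
proof -
  have "aff_dim F < DIM(real^'n)"
    using assms aff_dim_le_DIM[of K] by (auto simp: facet_of_def)
  then obtain a b where ab: "a \<noteq> 0" "F \<subseteq> {x. a \<bullet> x = b}"
    using aff_lowdim_subset_hyperplane by metis
  let ?n = "a /\<^sub>R norm a"
  have "norm ?n = 1" using ab by simp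
  moreover have "\<forall>x\<in>F. \<forall>y\<in>F. ?n \<bullet> (x - y) = 0"
    using ab(2) by (auto simp: inner_diff_right subset_iff)
  ultimately show ?thesis
    unfolding facet_normal_def by (rule_tac someI2[of _ ?n]) auto
qed

lemma prism_eq:
  fixes F K :: "(real^'n) set"
  assumes F: "F facet_of K" and c: "c \<in> F"
  defines "\<nu> \<equiv> facet_normal F"
  shows "prism F A = {y. y - ((y - c) \<bullet> \<nu>) *\<^sub>R \<nu> \<in> A \<inter> F \<and> (y - c) \<bullet> \<nu> \<in> {0..1}}"
proof -
  have n: "\<nu> \<bullet> \<nu> = 1" and o: "\<And>x. x \<in> F \<Longrightarrow> (x - c) \<bullet> \<nu> = 0"
    using facet_normal[OF F] c by (auto simp: \<nu>_def inner_commute norm_eq_1)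
  have h: "(x + s *\<^sub>R \<nu> - c) \<bullet> \<nu> = s" if "x \<in> F" for x s
    using o[OF that] n by (simp add: algebra_simps)
  show ?thesis
  proof (intro set_eqI iffI)
    fix y assume "y \<in> prism F A"
    then obtain x s where "y = x + s *\<^sub>R \<nu>" "x \<in> A" "x \<in> F" "0 \<le> s" "s \<le> 1"
      by (auto simp: prism_def \<nu>_def)
    then show "y \<in> {y. y - ((y - c) \<bullet> \<nu>) *\<^sub>R \<nu> \<in> A \<inter> F \<and> (y - c) \<bullet> \<nu> \<in> {0..1}}"
      using h by simp
  next
    fix y assume y: "y \<in> {y. y - ((y - c) \<bullet> \<nu>) *\<^sub>R \<nu> \<in> A \<inter> F \<and> (y - c) \<bullet> \<nu> \<in> {0..1}}"
    have "y = (y - ((y - c) \<bullet> \<nu>) *\<^sub>R \<nu>) + ((y - c) \<bullet> \<nu>) *\<^sub>R \<nu>" by simp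
    with y show "y \<in> prism F A"
      unfolding prism_def \<nu>_def[symmetric] by fastforce
  qed
qed

lemma prism_borel:
  fixes F K :: "(real^'n) set"
  assumes "F facet_of K" and "polytope K" and "A \<in> sets borel"
  shows "prism F A \<in> sets borel"
proof -
  obtain c where c: "c \<in> F" using assms(1) by (auto simp: facet_of_def)
  have "polytope F" using assms(1,2) face_of_polytope_polytope by (auto simp: facet_of_def)
  then have AF: "A \<inter> F \<in> sets borel"
    using assms(3) polytope_imp_closed[of F] borel_closed[of F] by (auto intro: sets.Int)
  let ?p = "\<lambda>y. y - ((y - c) \<bullet> facet_normal F) *\<^sub>R facet_normal F"
  have "?p -` (A \<inter> F) \<inter> space borel \<in> sets borel"
    by (rule measurable_sets[OF _ AF], intro borel_measurable_continuous_onI continuous_intros)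
  moreover have "(\<lambda>y. (y - c) \<bullet> facet_normal F) -` {0..1} \<inter> space borel \<in> sets borel"
    by (rule measurable_sets[of _ _ borel], intro borel_measurable_continuous_onI continuous_intros) auto
  moreover have "prism F A = (?p -` (A \<inter> F) \<inter> space borel) \<inter>
      ((\<lambda>y. (y - c) \<bullet> facet_normal F) -` {0..1} \<inter> space borel)"
    unfolding prism_eq[OF assms(1) c] by auto
  ultimately show ?thesis by (simp only: sets.Int)
qed

lemma emeasure_borel_surface_measure:
  assumes "simplicial_mesh \<Omega> \<T>" and "A \<in> sets borel"
  shows "emeasure (borel_surface_measure \<Omega> \<T>) A =
           (\<Sum>F\<in>boundary_facets \<Omega> \<T>. emeasure lborel (prism F A))"
proof (rule emeasure_measure_of[OF borel_surface_measure_def])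
  let ?s = "\<lambda>A. \<Sum>F\<in>boundary_facets \<Omega> \<T>. emeasure lborel (prism F A)"
  show "positive (sets (borel_surface_measure \<Omega> \<T>)) ?s"
    by (auto simp: positive_def prism_def)
  have sb: "sets (borel_surface_measure \<Omega> \<T>) = sets borel"
    unfolding borel_surface_measure_def
    using sets.sigma_sets_eq[of borel] by (simp add: sets_measure_of)
  show "countably_additive (sets (borel_surface_measure \<Omega> \<T>)) ?s"
    unfolding countably_additive_def sb
  proof (intro allI impI)
    fix A :: "nat \<Rightarrow> (real^'a) set"
    assume A: "range A \<subseteq> sets borel" "disjoint_family A" "\<Union>(range A) \<in> sets borel"
    have "(\<Sum>i. emeasure lborel (prism F (A i))) = emeasure lborel (prism F (\<Union>(range A)))"
      if F: "F \<in> boundary_facets \<Omega> \<T>" for F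
    proof -
      obtain K where K: "K \<in> \<T>" "F facet_of K" using F by (auto simp: boundary_facets_def)
      then obtain c where c: "c \<in> F" by (auto simp: facet_of_def)
      have "polytope K"
        using assms(1) K(1) by (auto simp: simplicial_mesh_def intro: simplex_imp_polytope)
      then have "range (\<lambda>i. prism F (A i)) \<subseteq> sets lborel"
        using prism_borel[OF K(2)] A(1) by auto
      moreover have "disjoint_family (\<lambda>i. prism F (A i))"
        using A(2) by (auto simp: disjoint_family_on_def prism_eq[OF K(2) c])
      ultimately have "(\<Sum>i. emeasure lborel (prism F (A i))) = emeasure lborel (\<Union>i. prism F (A i))"
        by (rule suminf_emeasure)
      also have "(\<Union>i. prism F (A i)) = prism F (\<Union>(range A))"
        by (auto simp: prism_def)
      finally show ?thesis .
    qed
    then show "(\<Sum>i. ?s (A i)) = ?s (\<Union>(range A))"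
      by (subst suminf_sum) auto
  qed
qed (use assms(2) in \<open>auto simp: borel_surface_measure_def\<close>)


section \<open>Finite element spaces\<close>

text \<open>Functions on a set \<open>S\<close> are represented by total functions that vanish off \<open>S\<close>, so that
  function equality is equality on \<open>S\<close> and \<open>0\<close> is the zero function.  Addition is the pointwise one
  of \<open>HOL-Library.Function_Algebras\<close>.\<close>

definition restr :: "'a set \<Rightarrow> ('a \<Rightarrow> complex) \<Rightarrow> 'a \<Rightarrow> complex" where
  "restr S h = (\<lambda>x. if x \<in> S then h x else 0)"

definition poly_fun :: "nat \<Rightarrow> (real^'n \<Rightarrow> complex) \<Rightarrow> bool" where
  "poly_fun k p \<longleftrightarrow> (\<exists>c :: ('n \<Rightarrow> nat) \<Rightarrow> complex.
     p = (\<lambda>x. \<Sum>\<alpha> | (\<Sum>i\<in>UNIV. \<alpha> i) \<le> k. c \<alpha> * complex_of_real (\<Prod>i\<in>UNIV. (x $ i) ^ \<alpha> i)))"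

definition Vh :: "(real^'n) set \<Rightarrow> (real^'n) set set \<Rightarrow> nat \<Rightarrow> (real^'n \<Rightarrow> complex) set" where
  "Vh \<Omega> \<T> k = {v. continuous_on (closure \<Omega>) v \<and> (\<forall>x. x \<notin> closure \<Omega> \<longrightarrow> v x = 0) \<and>
     (\<forall>K\<in>\<T>. \<exists>p. poly_fun k p \<and> (\<forall>x\<in>K. v x = p x))}"

definition Vh_on :: "(real^'n) set \<Rightarrow> (real^'n) set set \<Rightarrow> nat \<Rightarrow> (real^'n) set \<Rightarrow> (real^'n \<Rightarrow> complex) set"
  where "Vh_on \<Omega> \<T> k S = restr S ` Vh \<Omega> \<T> k"

text \<open>The elements of the broken space are \<open>L\<^sup>2\<close> classes.  Each class has exactly one representative
  that agrees on every (open) subdomain with a function of \<open>Vh\<close> and vanishes off the subdomains;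
  this one is used.\<close>

definition broken_Vh ::
  "(real^'n) set \<Rightarrow> (real^'n) set set \<Rightarrow> nat \<Rightarrow> ('j \<Rightarrow> (real^'n) set) \<Rightarrow> (real^'n \<Rightarrow> complex) set" where
  "broken_Vh \<Omega> \<T> k D = {u. (\<forall>j. restr (D j) u \<in> Vh_on \<Omega> \<T> k (D j)) \<and>
     (\<forall>x. x \<notin> (\<Union>j. D j) \<longrightarrow> u x = 0)}"

definition trace_from :: "(real^'n) set \<Rightarrow> (real^'n \<Rightarrow> complex) \<Rightarrow> real^'n \<Rightarrow> complex" where
  "trace_from S u x = Lim (at x within S) u"

definition multi_trace ::
  "('j \<Rightarrow> (real^'n) set) \<Rightarrow> (real^'n \<Rightarrow> complex) \<Rightarrow> 'j \<Rightarrow> real^'n \<Rightarrow> complex" where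
  "multi_trace D u = (\<lambda>j. restr (frontier (D j)) (trace_from (D j) u))"

definition multi_trace_space ::
  "(real^'n) set \<Rightarrow> (real^'n) set set \<Rightarrow> nat \<Rightarrow> ('j \<Rightarrow> (real^'n) set) \<Rightarrow> ('j \<Rightarrow> real^'n \<Rightarrow> complex) set" where
  "multi_trace_space \<Omega> \<T> k D = {p. \<forall>j. p j \<in> Vh_on \<Omega> \<T> k (frontier (D j))}"

definition single_trace_space ::
  "(real^'n) set \<Rightarrow> (real^'n) set set \<Rightarrow> nat \<Rightarrow> ('j \<Rightarrow> (real^'n) set) \<Rightarrow> ('j \<Rightarrow> real^'n \<Rightarrow> complex) set" where
  "single_trace_space \<Omega> \<T> k D = multi_trace D ` Vh \<Omega> \<T> k"


section \<open>Forms\<close>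

text \<open>Classical partial derivatives; for the functions considered here they exist off the mesh
  skeleton, a Lebesgue null set, and give the weak gradient on each subdomain.  All volume integrals
  are with respect to the complete measure \<open>lebesgue\<close>, for which the values on the skeleton
  are irrelevant.\<close>

definition partial_deriv :: "'n \<Rightarrow> (real^'n \<Rightarrow> complex) \<Rightarrow> real^'n \<Rightarrow> complex" where
  "partial_deriv i u x = frechet_derivative u (at x) (axis i 1)"

definition form_a :: "(real^'n) set \<Rightarrow> (real^'n) set set \<Rightarrow> ('j::finite \<Rightarrow> (real^'n) set) \<Rightarrow>
    (real^'n \<Rightarrow> complex) \<Rightarrow> (real^'n \<Rightarrow> real) \<Rightarrow> (real^'n \<Rightarrow> complex) \<Rightarrow> (real^'n \<Rightarrow> complex) \<Rightarrow> complex" where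
  "form_a \<Omega> \<T> D \<kappa> \<mu> u v = (\<Sum>j\<in>UNIV.
     (LINT x|lebesgue_on (D j).
        of_real (\<mu> x) * (\<Sum>i\<in>UNIV. partial_deriv i u x * cnj (partial_deriv i v x))
        - (\<kappa> x)\<^sup>2 * u x * cnj (v x))
     - \<i> * (LINT x : frontier (D j) \<inter> frontier \<Omega> | surface_measure \<Omega> \<T>.
        \<kappa> x * trace_from (D j) u x * cnj (trace_from (D j) v x)))"

definition form_l :: "(real^'n) set \<Rightarrow> (real^'n) set set \<Rightarrow> ('j::finite \<Rightarrow> (real^'n) set) \<Rightarrow>
    (real^'n \<Rightarrow> complex) \<Rightarrow> (real^'n \<Rightarrow> complex) \<Rightarrow> (real^'n \<Rightarrow> complex) \<Rightarrow> complex" where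
  "form_l \<Omega> \<T> D f g v = (\<Sum>j\<in>UNIV.
     (LINT x|lebesgue_on (D j). f x * cnj (v x))
     + (LINT x : frontier (D j) \<inter> frontier \<Omega> | surface_measure \<Omega> \<T>.
        g x * cnj (trace_from (D j) v x)))"

definition H1_norm :: "(real^'n) set \<Rightarrow> (real^'n \<Rightarrow> complex) \<Rightarrow> (real^'n \<Rightarrow> complex) \<Rightarrow> real" where
  "H1_norm \<Omega> \<kappa> v = sqrt ((LINT x|lebesgue_on \<Omega>. (\<Sum>i\<in>UNIV. (cmod (partial_deriv i v x))\<^sup>2))
     + (kappa_inf \<Omega> \<kappa>)\<^sup>2 * (LINT x|lebesgue_on \<Omega>. (cmod (v x))\<^sup>2))"

definition alpha_h :: "(real^'n) set \<Rightarrow> (real^'n) set set \<Rightarrow> nat \<Rightarrow> ('j::finite \<Rightarrow> (real^'n) set) \<Rightarrow>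
    (real^'n \<Rightarrow> complex) \<Rightarrow> (real^'n \<Rightarrow> real) \<Rightarrow> ereal" where
  "alpha_h \<Omega> \<T> k D \<kappa> \<mu> = (INF u\<in>Vh \<Omega> \<T> k - {0}. SUP v\<in>Vh \<Omega> \<T> k - {0}.
     ereal (cmod (form_a \<Omega> \<T> D \<kappa> \<mu> u v) / (H1_norm \<Omega> \<kappa> u * H1_norm \<Omega> \<kappa> v)))"


section \<open>Impedance, exchange and scattering operators\<close>

definition smul :: "complex \<Rightarrow> ('j \<Rightarrow> 'x \<Rightarrow> complex) \<Rightarrow> 'j \<Rightarrow> 'x \<Rightarrow> complex" (infixr \<open>*\<^sub>c\<close> 75) where
  "c *\<^sub>c p = (\<lambda>j x. c * p j x)"

definition scalar_product_on ::
  "('j \<Rightarrow> 'x \<Rightarrow> complex) set \<Rightarrow> (('j \<Rightarrow> 'x \<Rightarrow> complex) \<Rightarrow> ('j \<Rightarrow> 'x \<Rightarrow> complex) \<Rightarrow> complex) \<Rightarrow> bool" where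
  "scalar_product_on V t \<longleftrightarrow>
     (\<forall>p\<in>V. \<forall>q\<in>V. \<forall>w\<in>V. t (p + q) w = t p w + t q w) \<and>
     (\<forall>c. \<forall>p\<in>V. \<forall>w\<in>V. t (c *\<^sub>c p) w = c * t p w) \<and>
     (\<forall>p\<in>V. \<forall>q\<in>V. t q p = cnj (t p q)) \<and>
     (\<forall>p\<in>V. p \<noteq> 0 \<longrightarrow> 0 < Re (t p p))"

definition t_norm ::
  "(('j \<Rightarrow> 'x \<Rightarrow> complex) \<Rightarrow> ('j \<Rightarrow> 'x \<Rightarrow> complex) \<Rightarrow> complex) \<Rightarrow> ('j \<Rightarrow> 'x \<Rightarrow> complex) \<Rightarrow> real" where
  "t_norm t w = sqrt (Re (t w w))"

definition orthogonal_projector ::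
  "(('j \<Rightarrow> 'x \<Rightarrow> complex) \<Rightarrow> ('j \<Rightarrow> 'x \<Rightarrow> complex) \<Rightarrow> complex) \<Rightarrow> ('j \<Rightarrow> 'x \<Rightarrow> complex) set \<Rightarrow>
   ('j \<Rightarrow> 'x \<Rightarrow> complex) set \<Rightarrow> (('j \<Rightarrow> 'x \<Rightarrow> complex) \<Rightarrow> ('j \<Rightarrow> 'x \<Rightarrow> complex)) \<Rightarrow> bool" where
  "orthogonal_projector t V W P \<longleftrightarrow> (\<forall>p\<in>V. P p \<in> W \<and> (\<forall>w\<in>W. t (p - P p) w = 0))"

definition impedance_solution :: "(real^'n \<Rightarrow> complex) set \<Rightarrow> ('j \<Rightarrow> (real^'n) set) \<Rightarrow>
    ((real^'n \<Rightarrow> complex) \<Rightarrow> (real^'n \<Rightarrow> complex) \<Rightarrow> complex) \<Rightarrow>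
    (('j \<Rightarrow> real^'n \<Rightarrow> complex) \<Rightarrow> ('j \<Rightarrow> real^'n \<Rightarrow> complex) \<Rightarrow> complex) \<Rightarrow>
    ((real^'n \<Rightarrow> complex) \<Rightarrow> complex) \<Rightarrow> (real^'n \<Rightarrow> complex) \<Rightarrow> bool" where
  "impedance_solution V D a t F w \<longleftrightarrow> w \<in> V \<and>
     (\<forall>v\<in>V. a w v - \<i> * t (multi_trace D w) (multi_trace D v) = F v)"

definition scattering :: "(real^'n \<Rightarrow> complex) set \<Rightarrow> ('j \<Rightarrow> (real^'n) set) \<Rightarrow>
    ((real^'n \<Rightarrow> complex) \<Rightarrow> (real^'n \<Rightarrow> complex) \<Rightarrow> complex) \<Rightarrow>
    (('j \<Rightarrow> real^'n \<Rightarrow> complex) \<Rightarrow> ('j \<Rightarrow> real^'n \<Rightarrow> complex) \<Rightarrow> complex) \<Rightarrow>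
    ('j \<Rightarrow> real^'n \<Rightarrow> complex) \<Rightarrow> ('j \<Rightarrow> real^'n \<Rightarrow> complex)" where
  "scattering V D a t p = p + (2 * \<i>) *\<^sub>c multi_trace D
     (THE w. impedance_solution V D a t (\<lambda>v. t p (multi_trace D v)) w)"

definition skeleton_rhs :: "(real^'n \<Rightarrow> complex) set \<Rightarrow> ('j \<Rightarrow> (real^'n) set) \<Rightarrow>
    ((real^'n \<Rightarrow> complex) \<Rightarrow> (real^'n \<Rightarrow> complex) \<Rightarrow> complex) \<Rightarrow>
    (('j \<Rightarrow> real^'n \<Rightarrow> complex) \<Rightarrow> ('j \<Rightarrow> real^'n \<Rightarrow> complex) \<Rightarrow> complex) \<Rightarrow>
    ((real^'n \<Rightarrow> complex) \<Rightarrow> complex) \<Rightarrow>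
    (('j \<Rightarrow> real^'n \<Rightarrow> complex) \<Rightarrow> ('j \<Rightarrow> real^'n \<Rightarrow> complex)) \<Rightarrow> ('j \<Rightarrow> real^'n \<Rightarrow> complex)" where
  "skeleton_rhs V D a t l Pi_h =
     (- 2 * \<i>) *\<^sub>c Pi_h (multi_trace D (THE u. impedance_solution V D a t l u))"

definition gamma_h :: "('j \<Rightarrow> 'x \<Rightarrow> complex) set \<Rightarrow>
    (('j \<Rightarrow> 'x \<Rightarrow> complex) \<Rightarrow> ('j \<Rightarrow> 'x \<Rightarrow> complex) \<Rightarrow> complex) \<Rightarrow>
    (('j \<Rightarrow> 'x \<Rightarrow> complex) \<Rightarrow> ('j \<Rightarrow> 'x \<Rightarrow> complex)) \<Rightarrow>
    (('j \<Rightarrow> 'x \<Rightarrow> complex) \<Rightarrow> ('j \<Rightarrow> 'x \<Rightarrow> complex)) \<Rightarrow> real" where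
  "gamma_h W t Pi_h S = (INF w\<in>W - {0}. t_norm t (w + Pi_h (S w)) / t_norm t w)"

end

theory Submission
  imports Defs
begin

text \<open>Subtracting the fixed-point equation from the iteration gives, for the error
  \<open>e\<^sub>n = p\<^sub>n - p\<^sub>\<infinity>\<close>, the recursion \<open>e\<^sub>n\<^sub>+\<^sub>1 = (1 - r) e\<^sub>n - r \<Pi> S e\<^sub>n\<close>: the right-hand side of the local
  problems splits into a part driven by \<open>e\<^sub>n\<close>, a part driven by \<open>p\<^sub>\<infinity>\<close> and the part driven by \<open>\<ell>\<close>
  (\<open>local_solution_splits\<close>), and \<open>\<Pi>\<close> maps the joint contribution of the last two to \<open>- p\<^sub>\<infinity>\<close>.  In any inner product space
  \<open>\<parallel>(1 - r) x - r y\<parallel>\<^sup>2 = (1 - r) \<parallel>x\<parallel>\<^sup>2 + r \<parallel>y\<parallel>\<^sup>2 - r (1 - r) \<parallel>x + y\<parallel>\<^sup>2\<close>.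
  Take \<open>x = e\<^sub>n\<close> and \<open>y = \<Pi> S e\<^sub>n\<close>.  Since \<open>\<Pi> = 2P - 1\<close> is the reflection at the range of an orthogonal
  projector, it is an isometry (\<open>Pi_isometry\<close>).  Testing the local problem with its own solution \<open>w\<close>
  gives \<open>\<parallel>S p\<parallel>\<^sup>2 = \<parallel>p\<parallel>\<^sup>2 + 4 Im a(w,w)\<close> (\<open>energy_identity\<close>), and the signs of \<open>\<kappa>\<close> make the last term
  nonpositive (\<open>Im_form_a_le\<close>).  Hence \<open>\<parallel>y\<parallel> \<le> \<parallel>x\<parallel>\<close>, while \<open>\<parallel>x + y\<parallel> \<ge> \<gamma>\<^sub>h \<parallel>x\<parallel>\<close> by definition of \<open>\<gamma>\<^sub>h\<close>, and
  each step multiplies the squared error norm by at most \<open>1 - r(1-r)\<gamma>\<^sub>h\<^sup>2\<close>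
  (\<open>relaxed_iteration_decay\<close>).

  All this presupposes that the local problems are uniquely solvable, because \<open>S\<close> and the right-hand
  side of the skeleton equation are defined through their solutions.  A solution of the homogeneous
  problem has zero traces, by the same energy argument.  It is therefore globally continuous, hence an element \<open>w\<close> of \<open>V\<^sub>h\<close>
  with \<open>a(w,v) = 0\<close> for all \<open>v\<close> in \<open>V\<^sub>h\<close>, and the inf-sup condition forces it to be zero
  (\<open>homogeneous_solution_zero\<close>).  The broken space is finite-dimensional, so uniqueness implies
  existence (\<open>nondegenerate_form_solvable\<close>).  This uses that \<open>a\<close> is sesquilinear, that is, that
  all its integrands are integrable: finite element functions are polynomials off
  the mesh skeleton, which is a null set, and the coefficients are bounded and measurable.\<close>

section \<open>Finite-dimensional spaces of complex functions\<close>

lemma sum_fun_apply: "(\<Sum>i\<in>A. f i) x = (\<Sum>i\<in>A. f i x)"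
  for f :: "'i \<Rightarrow> 'x \<Rightarrow> complex"
  by (induction A rule: infinite_finite_induct) auto

definition cscale :: "complex \<Rightarrow> ('x \<Rightarrow> complex) \<Rightarrow> 'x \<Rightarrow> complex" where
  "cscale c h = (\<lambda>x. c * h x)"

interpretation cfun: vector_space "cscale :: complex \<Rightarrow> ('x \<Rightarrow> complex) \<Rightarrow> 'x \<Rightarrow> complex"
  by unfold_locales (auto simp: cscale_def fun_eq_iff algebra_simps)

interpretation cfun_pair: vector_space_pair
  "cscale :: complex \<Rightarrow> ('x \<Rightarrow> complex) \<Rightarrow> 'x \<Rightarrow> complex"
  "cscale :: complex \<Rightarrow> ('y \<Rightarrow> complex) \<Rightarrow> 'y \<Rightarrow> complex"
  by unfold_locales

definition antilinear_on :: "('x \<Rightarrow> complex) set \<Rightarrow> (('x \<Rightarrow> complex) \<Rightarrow> complex) \<Rightarrow> bool" where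
  "antilinear_on V F \<longleftrightarrow> (\<forall>u\<in>V. \<forall>v\<in>V. F (u + v) = F u + F v) \<and>
     (\<forall>c. \<forall>v\<in>V. F (cscale c v) = cnj c * F v)"

definition linear_functional_on :: "('x \<Rightarrow> complex) set \<Rightarrow> (('x \<Rightarrow> complex) \<Rightarrow> complex) \<Rightarrow> bool" where
  "linear_functional_on V F \<longleftrightarrow> (\<forall>u\<in>V. \<forall>v\<in>V. F (u + v) = F u + F v) \<and>
     (\<forall>c. \<forall>v\<in>V. F (cscale c v) = c * F v)"

text \<open>The set where two antilinear functionals agree is a subspace, so agreement on a spanning set
  suffices.\<close>

lemma antilinear_on_eqI:
  assumes V: "cfun.subspace V" "B \<subseteq> V" "V \<subseteq> cfun.span B"
    and F: "antilinear_on V F" "antilinear_on V G" "\<forall>v\<in>B. F v = G v"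
    and v: "v \<in> V"
  shows "F v = G v"
proof -
  have "F 0 = 0" "G 0 = 0"
    using F(1,2) cfun.subspace_0[OF V(1)] by (auto simp: antilinear_on_def dest!: bspec spec[of _ 0])
  then have "cfun.subspace {v \<in> V. F v = G v}"
    using V(1) F(1,2) by (auto simp: cfun.subspace_def antilinear_on_def)
  then have "cfun.span B \<subseteq> {v \<in> V. F v = G v}"
    using V(2) F(3) by (intro cfun.span_minimal) auto
  then show ?thesis using v V(3) by blast
qed

lemma linear_functional_on_sum:
  assumes "linear_functional_on V F" "cfun.subspace V" "finite B" "B \<subseteq> V"
  shows "F (\<Sum>y\<in>B. cscale (c y) y) = (\<Sum>y\<in>B. c y * F y)"
  using assms(3,4)
proof (induction B rule: finite_induct)
  case empty
  have "F (cscale 0 0) = 0 * F 0"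
    using assms(1) cfun.subspace_0[OF assms(2)] unfolding linear_functional_on_def by blast
  then show ?case by (simp add: zero_fun_def)
next
  case (insert y B)
  have "(\<Sum>y\<in>B. cscale (c y) y) \<in> V" "cscale (c y) y \<in> V"
    using insert.prems assms(2) by (auto intro!: cfun.subspace_sum cfun.subspace_scale)
  then show ?case
    using insert assms(1) by (simp add: linear_functional_on_def plus_fun_def)
qed

text \<open>Rank-nullity for the map \<open>u \<mapsto> b u\<close> from a finite-dimensional space to antilinear functionals.
  Over a basis \<open>B\<close>, coefficient vectors and values of functionals on \<open>B\<close> both live in the space of
  functions supported on \<open>B\<close>.  There the form acts as a linear endomorphism \<open>T\<close>, which is injective by
  nondegeneracy and hence surjective by the exchange lemma.\<close>

lemma nondegenerate_form_solvable:
  fixes V :: "('x \<Rightarrow> complex) set"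
  assumes V: "cfun.subspace V" and G: "finite G" "V \<subseteq> cfun.span G"
    and left: "\<And>v. v \<in> V \<Longrightarrow> linear_functional_on V (\<lambda>u. b u v)"
    and right: "\<And>u. u \<in> V \<Longrightarrow> antilinear_on V (b u)"
    and nondegenerate: "\<And>u. u \<in> V \<Longrightarrow> \<forall>v\<in>V. b u v = 0 \<Longrightarrow> u = 0"
    and F: "antilinear_on V F"
  shows "\<exists>w\<in>V. \<forall>v\<in>V. b w v = F v"
proof -
  obtain B where B: "B \<subseteq> V" "cfun.independent B" "V \<subseteq> cfun.span B"
    using cfun.maximal_independent_subset by metis
  have fB: "finite B"
    using cfun.independent_span_bound[OF G(1) B(2)] B(1) G(2) by blast
  define \<delta> :: "('x \<Rightarrow> complex) \<Rightarrow> ('x \<Rightarrow> complex) \<Rightarrow> complex"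
    where "\<delta> = (\<lambda>x y. if y = x then 1 else 0)"
  \<comment> \<open>The form in the coordinates given by \<open>B\<close>: a coefficient vector is sent to the values on \<open>B\<close> of
    the functional that it represents.\<close>
  define T :: "(('x \<Rightarrow> complex) \<Rightarrow> complex) \<Rightarrow> ('x \<Rightarrow> complex) \<Rightarrow> complex"
    where "T = (\<lambda>c x. if x \<in> B then (\<Sum>y\<in>B. c y * b y x) else 0)"
  have comb: "(\<Sum>y\<in>B. cscale (c y) y) \<in> V" for c
    using B(1) V by (auto intro!: cfun.subspace_sum cfun.subspace_scale)
  have T_eq: "T c x = b (\<Sum>y\<in>B. cscale (c y) y) x" if "x \<in> B" for c x
    using linear_functional_on_sum[OF left V fB B(1), of x c] that B(1) by (auto simp: T_def)
  have supp: "c \<in> cfun.span (\<delta> ` B)" if "\<And>x. x \<notin> B \<Longrightarrow> c x = 0" for c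
  proof -
    have "c = (\<Sum>x\<in>B. cscale (c x) (\<delta> x))"
      by (rule ext)
        (use that fB in \<open>auto simp: sum_fun_apply cscale_def \<delta>_def if_distrib cong: if_cong\<close>)
    then show ?thesis
      by (metis (no_types, lifting) cfun.span_base cfun.span_scale cfun.span_sum image_eqI)
  qed
  have supp': "c x = 0" if "c \<in> cfun.span (\<delta> ` B)" "x \<notin> B" for c x
  proof -
    have "cfun.subspace {c. c x = 0}" by (auto simp: cfun.subspace_def cscale_def)
    then have "cfun.span (\<delta> ` B) \<subseteq> {c. c x = 0}"
      using that(2) by (intro cfun.span_minimal) (auto simp: \<delta>_def)
    then show ?thesis using that(1) by auto
  qed
  have inj_\<delta>: "inj_on \<delta> B"
    by (rule inj_onI) (metis \<delta>_def zero_neq_one)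
  have ind_\<delta>: "cfun.independent (\<delta> ` B)"
  proof -
    have "False" if s: "(\<Sum>v\<in>\<delta> ` B. cscale (c v) v) = 0" and x: "x \<in> B" "c (\<delta> x) \<noteq> 0" for c x
    proof -
      have "0 = (\<Sum>y\<in>B. cscale (c (\<delta> y)) (\<delta> y)) x"
        using s by (simp add: sum.reindex[OF inj_\<delta>])
      also have "\<dots> = c (\<delta> x)"
        using fB x by (simp add: sum_fun_apply cscale_def \<delta>_def if_distrib cong: if_cong)
      finally show False using x by simp
    qed
    then show ?thesis
      unfolding cfun.dependent_finite[OF finite_imageI[OF fB]] by blast
  qed
  have lin: "Vector_Spaces.linear cscale cscale T"
    by (auto simp: Vector_Spaces.linear_iff T_def fun_eq_iff cscale_def algebra_simps sum.distrib sum_distrib_left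
      intro!: cfun.vector_space_axioms)
  have inj: "inj_on T (cfun.span (\<delta> ` B))"
  proof -
    have "c = 0" if c: "c \<in> cfun.span (\<delta> ` B)" "T c = 0" for c
    proof -
      let ?u = "\<Sum>y\<in>B. cscale (c y) y"
      have "\<forall>v\<in>B. b ?u v = 0" using T_eq c(2) by (metis zero_fun_apply)
      then have "\<forall>v\<in>V. b ?u v = 0"
        using antilinear_on_eqI[OF V B(1,3) right[OF comb], of "\<lambda>_. 0"] by (auto simp: antilinear_on_def)
      then have "?u = 0" using nondegenerate comb by blast
      then have "\<forall>y\<in>B. c y = 0"
        using B(2) unfolding cfun.dependent_finite[OF fB] by blast
      then show ?thesis using supp'[OF c(1)] by (auto simp: fun_eq_iff)
    qed
    then show ?thesis
      using cfun_pair.linear_inj_on_iff_eq_0[OF lin cfun.subspace_span] by blast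
  qed
  have ind_T: "cfun.independent (T ` \<delta> ` B)"
    using cfun_pair.linear_independent_injective_image[OF lin ind_\<delta> inj] .
  have card_T: "card (T ` \<delta> ` B) = card B"
    using card_image[OF inj_on_subset[OF inj cfun.span_superset]] card_image[OF inj_\<delta>] by simp
  define F' where "F' = (\<lambda>x. if x \<in> B then F x else 0)"
  \<comment> \<open>Otherwise \<open>F'\<close> and the images under \<open>T\<close> would be \<open>card B + 1\<close> independent vectors in a space
    spanned by \<open>card B\<close> vectors.\<close>
  have "F' \<in> cfun.span (T ` \<delta> ` B)"
  proof (rule ccontr)
    assume F': "F' \<notin> cfun.span (T ` \<delta> ` B)"
    then have "cfun.independent (insert F' (T ` \<delta> ` B))"
      using ind_T by (simp add: cfun.independent_insert)
    moreover have "insert F' (T ` \<delta> ` B) \<subseteq> cfun.span (\<delta> ` B)"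
      using supp by (auto simp: F'_def T_def)
    ultimately have "card (insert F' (T ` \<delta> ` B)) \<le> card (\<delta> ` B)"
      using cfun.independent_span_bound fB by blast
    moreover have "F' \<notin> T ` \<delta> ` B" using F' by (metis cfun.span_base)
    ultimately show False
      using fB card_T card_image[OF inj_\<delta>] by simp
  qed
  then obtain c where c: "F' = T c"
    unfolding cfun_pair.linear_span_image[OF lin] by blast
  have "\<forall>v\<in>B. b (\<Sum>y\<in>B. cscale (c y) y) v = F v"
    using T_eq c by (metis F'_def)
  then show ?thesis
    using antilinear_on_eqI[OF V B(1,3) right[OF comb] F] comb by blast
qed

section \<open>Scalar products and reflections\<close>

text \<open>The multi-trace space carries no type of its own, so the Hilbert space arguments are made relative
  to a set closed under the vector operations.\<close>

locale scalar_product_space =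
  fixes W :: "('j \<Rightarrow> 'x \<Rightarrow> complex) set"
    and t :: "('j \<Rightarrow> 'x \<Rightarrow> complex) \<Rightarrow> ('j \<Rightarrow> 'x \<Rightarrow> complex) \<Rightarrow> complex"
  assumes scalar_product: "scalar_product_on W t"
    and add_closed: "p \<in> W \<Longrightarrow> q \<in> W \<Longrightarrow> p + q \<in> W"
    and smul_closed: "p \<in> W \<Longrightarrow> c *\<^sub>c p \<in> W"
begin

lemma minus_eq_smul: "p - q = p + (-1) *\<^sub>c q" for p q :: "'j \<Rightarrow> 'x \<Rightarrow> complex"
  by (auto simp: smul_def fun_eq_iff)

lemma diff_closed: "p \<in> W \<Longrightarrow> q \<in> W \<Longrightarrow> p - q \<in> W"
  unfolding minus_eq_smul[of p q] by (intro add_closed smul_closed)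

lemmas product_laws = scalar_product[unfolded scalar_product_on_def]
lemmas t_add_left = product_laws[THEN conjunct1, rule_format]
  and t_smul_left = product_laws[THEN conjunct2, THEN conjunct1, rule_format]
  and t_commute = product_laws[THEN conjunct2, THEN conjunct2, THEN conjunct1, rule_format]
  and t_pos = product_laws[THEN conjunct2, THEN conjunct2, THEN conjunct2, rule_format]

lemma t_add_right: "p \<in> W \<Longrightarrow> q \<in> W \<Longrightarrow> w \<in> W \<Longrightarrow> t w (p + q) = t w p + t w q"
  using t_commute[of "p + q" w] t_commute[of p w] t_commute[of q w]
  by (simp add: t_add_left add_closed)

lemma t_smul_right: "p \<in> W \<Longrightarrow> w \<in> W \<Longrightarrow> t w (c *\<^sub>c p) = cnj c * t w p"
  using t_commute[of "c *\<^sub>c p" w] t_commute[of p w]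
  by (simp add: t_smul_left smul_closed)

lemma t_diff_left: "p \<in> W \<Longrightarrow> q \<in> W \<Longrightarrow> w \<in> W \<Longrightarrow> t (p - q) w = t p w - t q w"
  unfolding minus_eq_smul[of p q] by (simp add: t_add_left t_smul_left smul_closed)

lemma t_zero: "w \<in> W \<Longrightarrow> t 0 w = 0"
proof -
  assume w: "w \<in> W"
  have "(0 :: 'j \<Rightarrow> 'x \<Rightarrow> complex) = 0 *\<^sub>c w" by (auto simp: smul_def fun_eq_iff)
  then show ?thesis using t_smul_left[OF w w, of 0] by simp
qed

lemma t_self: "p \<in> W \<Longrightarrow> 0 \<le> Re (t p p)"
  using t_pos[of p] t_zero[of p] by (cases "p = 0") auto

lemma t_self_real: "p \<in> W \<Longrightarrow> Im (t p p) = 0"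
  using arg_cong[OF t_commute[of p p], of Im] by simp

lemma t_norm_sq: "p \<in> W \<Longrightarrow> (t_norm t p)\<^sup>2 = Re (t p p)"
  by (simp add: t_norm_def t_self)

lemma t_norm_nonneg: "p \<in> W \<Longrightarrow> 0 \<le> t_norm t p"
  by (simp add: t_norm_def t_self)

lemma t_norm_pos: "p \<in> W \<Longrightarrow> p \<noteq> 0 \<Longrightarrow> 0 < t_norm t p"
  by (simp add: t_norm_def t_pos)

lemma t_norm_sq_add_smul:
  assumes "p \<in> W" "q \<in> W"
  shows "(t_norm t (p + c *\<^sub>c q))\<^sup>2
    = (t_norm t p)\<^sup>2 + (cmod c)\<^sup>2 * (t_norm t q)\<^sup>2 + 2 * Re (cnj c * t p q)"
proof -
  have "t (p + c *\<^sub>c q) (p + c *\<^sub>c q)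
      = t p p + c * cnj c * t q q + (cnj c * t p q + cnj (cnj c * t p q))"
    using assms t_commute[OF assms]
    by (simp add: t_add_left t_add_right t_smul_left t_smul_right add_closed smul_closed algebra_simps)
  then show ?thesis
    using assms t_self_real[OF assms(2)]
    by (simp add: t_norm_sq add_closed smul_closed complex_mult_cnj cmod_power2 algebra_simps)
qed

text \<open>The quantitative strict convexity behind the convergence rate: the last term is the gain
  over the convex combination of the squared norms.\<close>

lemma t_norm_sq_relaxation:
  assumes "p \<in> W" "q \<in> W"
  shows "(t_norm t (of_real (1 - r) *\<^sub>c p - of_real r *\<^sub>c q))\<^sup>2
    = (1 - r) * (t_norm t p)\<^sup>2 + r * (t_norm t q)\<^sup>2 - r * (1 - r) * (t_norm t (p + q))\<^sup>2"
proof -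
  have 1: "of_real (1 - r) *\<^sub>c p - of_real r *\<^sub>c q = of_real (1 - r) *\<^sub>c p + of_real (- r) *\<^sub>c q"
    by (auto simp: smul_def fun_eq_iff)
  have 2: "(t_norm t (c *\<^sub>c p))\<^sup>2 = (cmod c)\<^sup>2 * (t_norm t p)\<^sup>2" for c
  proof -
    have "t (c *\<^sub>c p) (c *\<^sub>c p) = of_real ((cmod c)\<^sup>2) * t p p"
      using assms unfolding complex_norm_square by (simp add: smul_closed t_smul_left t_smul_right)
    then show ?thesis using assms by (simp add: t_norm_sq smul_closed)
  qed
  have 3: "(t_norm t (p + q))\<^sup>2 = (t_norm t p)\<^sup>2 + (t_norm t q)\<^sup>2 + 2 * Re (t p q)"
    using t_norm_sq_add_smul[OF assms, of 1] by (simp add: smul_def)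
  have 4: "(cmod (of_real (1 - r)))\<^sup>2 = (1 - r)\<^sup>2" "(cmod (of_real (- r)))\<^sup>2 = r\<^sup>2"
    unfolding norm_of_real by simp_all
  show ?thesis
    unfolding 1 t_norm_sq_add_smul[OF smul_closed[OF assms(1)] assms(2)] 2 3 4
    using assms by (simp add: t_smul_left smul_closed power2_eq_square algebra_simps)
qed

end

text \<open>The exchange operator is specified only through \<open>(q + \<Pi> q)/2\<close> being an orthogonal projection.
  Uniqueness of the projection yields its linearity.\<close>

locale t_reflection = scalar_product_space W t for W t +
  fixes U :: "('j \<Rightarrow> 'x \<Rightarrow> complex) set" and Pi_h
  assumes U: "U \<subseteq> W" "p \<in> U \<Longrightarrow> q \<in> U \<Longrightarrow> p + q \<in> U" "p \<in> U \<Longrightarrow> c *\<^sub>c p \<in> U"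
    and Pi_closed: "q \<in> W \<Longrightarrow> Pi_h q \<in> W"
    and projector: "orthogonal_projector t W U (\<lambda>q. (1/2) *\<^sub>c (q + Pi_h q))"
begin

abbreviation "P q \<equiv> (1/2) *\<^sub>c (q + Pi_h q)"

lemma P_in: "q \<in> W \<Longrightarrow> P q \<in> U" and P_orth: "q \<in> W \<Longrightarrow> w \<in> U \<Longrightarrow> t (q - P q) w = 0"
  using projector by (auto simp: orthogonal_projector_def)

lemma P_unique:
  assumes "q \<in> W" "s \<in> U" "\<And>w. w \<in> U \<Longrightarrow> t (q - s) w = 0"
  shows "P q = s"
proof (rule ccontr)
  assume ne: "P q \<noteq> s"
  let ?d = "s - P q"
  have dU: "?d \<in> U" unfolding minus_eq_smul[of s] using assms(1,2) by (intro U P_in)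
  have mem: "q \<in> W" "s \<in> W" "P q \<in> W" "?d \<in> W" using assms U(1) P_in dU by auto
  have "t ?d ?d = t (q - P q) ?d - t (q - s) ?d"
    using mem by (simp add: t_diff_left diff_closed)
  also have "\<dots> = 0" using assms P_orth dU by simp
  finally show False using t_pos[of ?d] mem ne by simp
qed

lemma Pi_eq: "Pi_h q = 2 *\<^sub>c P q - q"
  by (intro ext) (simp add: smul_def add_divide_distrib)

lemma Pi_add:
  assumes "p \<in> W" "q \<in> W" shows "Pi_h (p + q) = Pi_h p + Pi_h q"
proof -
  have "P (p + q) = P p + P q"
  proof (rule P_unique)
    fix w assume w: "w \<in> U"
    have "t (p + q - (P p + P q)) w = t (p - P p) w + t (q - P q) w"
      using assms w U(1) P_in by (simp add: t_diff_left t_add_left add_closed subset_iff)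
    then show "t (p + q - (P p + P q)) w = 0" using P_orth assms w by simp
  qed (use assms add_closed U P_in in auto)
  then have "Pi_h (p + q) = 2 *\<^sub>c (P p + P q) - (p + q)" using Pi_eq[of "p + q"] by simp
  also have "\<dots> = (2 *\<^sub>c P p - p) + (2 *\<^sub>c P q - q)"
    by (auto simp: smul_def fun_eq_iff algebra_simps)
  finally show ?thesis by (simp only: Pi_eq[symmetric])
qed

lemma Pi_smul:
  assumes "p \<in> W" shows "Pi_h (c *\<^sub>c p) = c *\<^sub>c Pi_h p"
proof -
  have "P (c *\<^sub>c p) = c *\<^sub>c P p"
  proof (rule P_unique)
    fix w assume w: "w \<in> U"
    have "t (c *\<^sub>c p - c *\<^sub>c P p) w = c * t (p - P p) w"
      using assms w U(1) P_in by (simp add: t_diff_left t_smul_left smul_closed subset_iff algebra_simps)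
    then show "t (c *\<^sub>c p - c *\<^sub>c P p) w = 0" using P_orth assms w by simp
  qed (use assms smul_closed U P_in in auto)
  then have "Pi_h (c *\<^sub>c p) = 2 *\<^sub>c (c *\<^sub>c P p) - c *\<^sub>c p" using Pi_eq[of "c *\<^sub>c p"] by simp
  also have "\<dots> = c *\<^sub>c (2 *\<^sub>c P p - p)"
    by (auto simp: smul_def fun_eq_iff algebra_simps)
  finally show ?thesis by (simp only: Pi_eq[symmetric])
qed

text \<open>By Pythagoras, \<open>q\<close> and its mirror image \<open>P q - (q - P q)\<close> have the same norm.\<close>

lemma Pi_isometry:
  assumes "q \<in> W" shows "t_norm t (Pi_h q) = t_norm t q"
proof -
  have mem: "q \<in> W" "P q \<in> U" "P q \<in> W" "q - P q \<in> W" using assms P_in U(1) diff_closed by auto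
  have 0: "t (q - P q) (P q) = 0" using P_orth mem by simp
  have pyth: "(t_norm t (q - P q + c *\<^sub>c P q))\<^sup>2
      = (t_norm t (q - P q))\<^sup>2 + (cmod c)\<^sup>2 * (t_norm t (P q))\<^sup>2" for c
    using t_norm_sq_add_smul[OF mem(4,3)] 0 by simp
  have "q = q - P q + 1 *\<^sub>c P q" by (auto simp: smul_def fun_eq_iff)
  then have "(t_norm t q)\<^sup>2 = (t_norm t (q - P q + (-1) *\<^sub>c P q))\<^sup>2"
    using pyth[of 1] pyth[of "-1"] by simp
  also have "q - P q + (-1) *\<^sub>c P q = (-1) *\<^sub>c Pi_h q"
    by (intro ext) (simp add: smul_def add_divide_distrib)
  also have "(t_norm t \<dots>)\<^sup>2 = (t_norm t (Pi_h q))\<^sup>2"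
    using Pi_closed[OF assms] by (simp add: t_norm_sq t_smul_left t_smul_right smul_closed)
  finally show ?thesis
    using t_norm_nonneg assms Pi_closed by simp
qed

end

section \<open>Finite element spaces and traces\<close>

lemma poly_fun_add: "poly_fun k p \<Longrightarrow> poly_fun k q \<Longrightarrow> poly_fun k (p + q)"
proof -
  assume "poly_fun k p" "poly_fun k q"
  then obtain c d where
    "p = (\<lambda>x. \<Sum>\<alpha> | (\<Sum>i\<in>UNIV. \<alpha> i) \<le> k. c \<alpha> * complex_of_real (\<Prod>i\<in>UNIV. (x $ i) ^ \<alpha> i))"
    "q = (\<lambda>x. \<Sum>\<alpha> | (\<Sum>i\<in>UNIV. \<alpha> i) \<le> k. d \<alpha> * complex_of_real (\<Prod>i\<in>UNIV. (x $ i) ^ \<alpha> i))"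
    unfolding poly_fun_def by blast
  then show ?thesis
    unfolding poly_fun_def
    by (intro exI[of _ "\<lambda>\<alpha>. c \<alpha> + d \<alpha>"]) (simp add: fun_eq_iff sum.distrib distrib_right)
qed

lemma poly_fun_cscale: "poly_fun k p \<Longrightarrow> poly_fun k (cscale a p)"
proof -
  assume "poly_fun k p"
  then obtain c where
    "p = (\<lambda>x. \<Sum>\<alpha> | (\<Sum>i\<in>UNIV. \<alpha> i) \<le> k. c \<alpha> * complex_of_real (\<Prod>i\<in>UNIV. (x $ i) ^ \<alpha> i))"
    unfolding poly_fun_def by blast
  then show ?thesis
    unfolding poly_fun_def cscale_def
    by (intro exI[of _ "\<lambda>\<alpha>. a * c \<alpha>"]) (simp add: fun_eq_iff sum_distrib_left mult.assoc)
qed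

lemma poly_fun_zero: "poly_fun k 0"
  unfolding poly_fun_def by (intro exI[of _ "\<lambda>_. 0"]) (simp add: fun_eq_iff)

lemma subspace_Vh: "cfun.subspace (Vh \<Omega> \<T> k)"
proof -
  have "u + v \<in> Vh \<Omega> \<T> k" if u: "u \<in> Vh \<Omega> \<T> k" and v: "v \<in> Vh \<Omega> \<T> k" for u v
  proof -
    have "\<exists>p. poly_fun k p \<and> (\<forall>x\<in>K. (u + v) x = p x)" if K: "K \<in> \<T>" for K
    proof -
      obtain p q where "poly_fun k p" "\<forall>x\<in>K. u x = p x" "poly_fun k q" "\<forall>x\<in>K. v x = q x"
        using u v K unfolding Vh_def by blast
      then show ?thesis by (intro exI[of _ "p + q"]) (simp add: poly_fun_add)
    qed
    then show ?thesis
      using u v by (auto simp: Vh_def plus_fun_def intro: continuous_on_add)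
  qed
  moreover have "cscale c u \<in> Vh \<Omega> \<T> k" if u: "u \<in> Vh \<Omega> \<T> k" for u c
  proof -
    have "\<exists>p. poly_fun k p \<and> (\<forall>x\<in>K. cscale c u x = p x)" if K: "K \<in> \<T>" for K
    proof -
      obtain p where "poly_fun k p" "\<forall>x\<in>K. u x = p x"
        using u K unfolding Vh_def by blast
      then show ?thesis by (intro exI[of _ "cscale c p"]) (simp add: poly_fun_cscale, simp add: cscale_def)
    qed
    then show ?thesis
      using u by (auto simp: Vh_def cscale_def intro: continuous_on_mult_left)
  qed
  moreover have "0 \<in> Vh \<Omega> \<T> k"
    using poly_fun_zero[of k] by (auto simp: Vh_def zero_fun_def intro!: exI[of _ "\<lambda>_. 0"])
  ultimately show ?thesis by (simp add: cfun.subspace_def)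
qed

lemma restr_add: "restr S (u + v) = restr S u + restr S v"
  and restr_cscale: "restr S (cscale c u) = cscale c (restr S u)"
  by (auto simp: restr_def cscale_def fun_eq_iff)

lemma subspace_Vh_on: "cfun.subspace (Vh_on \<Omega> \<T> k S)"
proof -
  have "Vector_Spaces.linear cscale cscale (restr S)"
    by (auto simp: Vector_Spaces.linear_iff restr_add restr_cscale intro!: cfun.vector_space_axioms)
  then show ?thesis
    unfolding Vh_on_def by (rule cfun_pair.linear_subspace_image[OF _ subspace_Vh])
qed

lemma subspace_broken_Vh: "cfun.subspace (broken_Vh \<Omega> \<T> k D)"
proof -
  have "restr S (0::_ \<Rightarrow> complex) = 0" for S :: "(real^'a) set" by (auto simp: restr_def fun_eq_iff)
  then show ?thesis
    using subspace_Vh_on[of \<Omega> \<T> k]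
    by (auto simp: broken_Vh_def cfun.subspace_def restr_add restr_cscale cscale_def[THEN fun_cong])
qed

lemma smul_apply: "(c *\<^sub>c p) j = cscale c (p j)"
  by (simp add: smul_def cscale_def)

lemma multi_trace_space_add:
  "p \<in> multi_trace_space \<Omega> \<T> k D \<Longrightarrow> q \<in> multi_trace_space \<Omega> \<T> k D \<Longrightarrow> p + q \<in> multi_trace_space \<Omega> \<T> k D"
  and multi_trace_space_smul: "p \<in> multi_trace_space \<Omega> \<T> k D \<Longrightarrow> c *\<^sub>c p \<in> multi_trace_space \<Omega> \<T> k D"
  unfolding multi_trace_space_def
  by (auto simp: smul_apply intro!: cfun.subspace_add[OF subspace_Vh_on] cfun.subspace_scale[OF subspace_Vh_on])

lemma finite_multi_indices: "finite {\<alpha> :: 'n::finite \<Rightarrow> nat. (\<Sum>i\<in>UNIV. \<alpha> i) \<le> k}"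
proof (rule finite_subset)
  show "{\<alpha> :: 'n \<Rightarrow> nat. (\<Sum>i\<in>UNIV. \<alpha> i) \<le> k} \<subseteq> PiE UNIV (\<lambda>_. {..k})"
  proof
    fix \<alpha> :: "'n \<Rightarrow> nat" assume a: "\<alpha> \<in> {\<alpha>. (\<Sum>i\<in>UNIV. \<alpha> i) \<le> k}"
    have "\<alpha> i \<le> (\<Sum>i\<in>UNIV. \<alpha> i)" for i by (rule member_le_sum) auto
    then show "\<alpha> \<in> PiE UNIV (\<lambda>_. {..k})" using a order_trans by fastforce
  qed
qed (auto intro: finite_PiE)

locale decomposed_mesh =
  fixes \<Omega> :: "(real^'n) set" and \<T> :: "(real^'n) set set" and k :: nat
    and D :: "'j::finite \<Rightarrow> (real^'n) set"
  assumes domain: "polyhedral_domain \<Omega>"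
    and mesh: "simplicial_mesh \<Omega> \<T>"
    and partition: "mesh_partition \<Omega> \<T> D"
begin

abbreviation "V0 \<equiv> Vh \<Omega> \<T> k"
abbreviation "V \<equiv> broken_Vh \<Omega> \<T> k D"
abbreviation "W \<equiv> multi_trace_space \<Omega> \<T> k D"

lemma finite_mesh: "finite \<T>"
  and simplex_mesh: "K \<in> \<T> \<Longrightarrow> int CARD('n) simplex K"
  and Union_mesh: "\<Union>\<T> = closure \<Omega>"
  and face_mesh: "K \<in> \<T> \<Longrightarrow> K' \<in> \<T> \<Longrightarrow> K \<inter> K' face_of K"
  using mesh by (auto simp: simplicial_mesh_def triangulation_def)

lemma open_D: "open (D j)"
  and disjoint_D: "i \<noteq> j \<Longrightarrow> D i \<inter> D j = {}"
  and cells_D: "\<exists>C\<subseteq>\<T>. closure (D j) = \<Union>C"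
  and Union_closure_D: "(\<Union>j. closure (D j)) = closure \<Omega>"
  using partition by (auto simp: mesh_partition_def polyhedral_open_def)

lemma bounded_\<Omega>: "bounded \<Omega>" and open_\<Omega>: "open \<Omega>" and regular_\<Omega>: "interior (closure \<Omega>) = \<Omega>"
  using domain by (auto simp: polyhedral_domain_def polyhedral_open_def)

lemma closure_D: "closure (D j) \<subseteq> closure \<Omega>"
  using Union_closure_D by blast

lemma D_subset: "D j \<subseteq> \<Omega>"
  using interior_maximal[OF subset_trans[OF closure_subset closure_D] open_D] regular_\<Omega> by simp

lemma frontier_D: "frontier (D j) \<subseteq> closure \<Omega>"
  using closure_D by (auto simp: frontier_def)

lemma frontier_D_disjoint: "frontier (D j) \<inter> D i = {}"
proof (cases "i = j")
  case True then show ?thesis using open_D by (auto simp: frontier_def interior_open)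
next
  case False
  then have "D i \<inter> closure (D j) = {}"
    using disjoint_D open_D by (simp add: open_Int_closure_eq_empty)
  then show ?thesis by (auto simp: frontier_def)
qed

text \<open>A relative interior point of \<open>K\<close> lies in some cell \<open>K'\<close> of some subdomain.  The face \<open>K \<inter> K'\<close> of \<open>K\<close>
  contains this point, so it is all of \<open>K\<close>.\<close>

lemma cell_in_subdomain:
  assumes K: "K \<in> \<T>" shows "\<exists>j. K \<subseteq> closure (D j)"
proof -
  have "K \<noteq> {}" "convex K"
    using simplex_mesh[OF K] by (auto simp: convex_simplex simplex_def)
  then obtain x where x: "x \<in> rel_interior K" using rel_interior_eq_empty by blast
  then have xK: "x \<in> K" using rel_interior_subset by blast
  then obtain j where "x \<in> closure (D j)" using Union_mesh Union_closure_D K by blast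
  then obtain K' where K': "K' \<in> \<T>" "x \<in> K'" "K' \<subseteq> closure (D j)" using cells_D[of j] by (metis UnionE Union_upper subsetD)
  have "K \<subseteq> K \<inter> K'"
    by (rule subset_of_face_of[OF face_mesh[OF K K'(1)]]) (use x xK K' in auto)
  then show ?thesis using K' by blast
qed

lemma Vh_continuous: "v \<in> V0 \<Longrightarrow> continuous_on (closure \<Omega>) v"
  by (simp add: Vh_def)

lemma brokenE:
  assumes "u \<in> V"
  obtains v where "v \<in> V0" "\<And>x. x \<in> D j \<Longrightarrow> u x = v x"
proof -
  obtain v where v: "v \<in> V0" "restr (D j) u = restr (D j) v"
    using assms by (auto simp: broken_Vh_def Vh_on_def)
  have "u x = v x" if "x \<in> D j" for x
    using fun_cong[OF v(2), of x] that by (simp add: restr_def)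
  then show ?thesis using that v by blast
qed

text \<open>On each subdomain a broken function agrees with a globally continuous one, whose values on the
  frontier are the interior limits.\<close>

lemma trace_from_eq:
  assumes v: "v \<in> V0" "\<And>x. x \<in> D j \<Longrightarrow> u x = v x" and x: "x \<in> frontier (D j)"
  shows "trace_from (D j) u x = v x"
proof -
  have "x islimpt D j"
    using x open_D by (auto simp: frontier_def interior_open closure_def)
  then have nt: "at x within D j \<noteq> bot" by (simp add: trivial_limit_within)
  have "(v \<longlongrightarrow> v x) (at x within closure \<Omega>)"
    using Vh_continuous[OF v(1)] frontier_D x by (auto simp: continuous_on_def)
  then have "(v \<longlongrightarrow> v x) (at x within D j)"
    by (rule tendsto_within_subset) (use closure_D closure_subset in blast)
  moreover have "eventually (\<lambda>y. u y = v y) (at x within D j)"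
    using v(2) by (auto simp: eventually_at_filter)
  ultimately have "(u \<longlongrightarrow> v x) (at x within D j)" by (simp add: tendsto_cong)
  then show ?thesis
    unfolding trace_from_def using nt by (intro tendsto_Lim) auto
qed

lemma multi_trace_eq:
  assumes "v \<in> V0" "\<And>x. x \<in> D j \<Longrightarrow> u x = v x"
  shows "multi_trace D u j = restr (frontier (D j)) v"
  using trace_from_eq[OF assms] by (auto simp: multi_trace_def restr_def)

lemma trace_from_add:
  assumes "u \<in> V" "v \<in> V" "x \<in> frontier (D j)"
  shows "trace_from (D j) (u + v) x = trace_from (D j) u x + trace_from (D j) v x"
proof -
  obtain u' v' where *: "u' \<in> V0" "\<And>x. x \<in> D j \<Longrightarrow> u x = u' x" "v' \<in> V0" "\<And>x. x \<in> D j \<Longrightarrow> v x = v' x"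
    using assms brokenE by metis
  have "trace_from (D j) (u + v) x = (u' + v') x"
    using assms(3) * by (intro trace_from_eq cfun.subspace_add[OF subspace_Vh]) auto
  then show ?thesis using trace_from_eq[OF *(1,2)] trace_from_eq[OF *(3,4)] assms by simp
qed

lemma trace_from_cscale:
  assumes "u \<in> V" "x \<in> frontier (D j)"
  shows "trace_from (D j) (cscale c u) x = c * trace_from (D j) u x"
proof -
  obtain u' where *: "u' \<in> V0" "\<And>x. x \<in> D j \<Longrightarrow> u x = u' x"
    using assms brokenE by metis
  have "trace_from (D j) (cscale c u) x = cscale c u' x"
    by (rule trace_from_eq) (use * assms cfun.subspace_scale[OF subspace_Vh] in \<open>auto simp: cscale_def\<close>)
  then show ?thesis using trace_from_eq[OF *] assms by (simp add: cscale_def)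
qed

lemma multi_trace_add: "u \<in> V \<Longrightarrow> v \<in> V \<Longrightarrow> multi_trace D (u + v) = multi_trace D u + multi_trace D v"
  and multi_trace_cscale: "u \<in> V \<Longrightarrow> multi_trace D (cscale c u) = c *\<^sub>c multi_trace D u"
  by (intro ext; simp add: multi_trace_def restr_def trace_from_add trace_from_cscale smul_def)+

lemma multi_trace_in: "u \<in> V \<Longrightarrow> multi_trace D u \<in> W"
proof -
  assume u: "u \<in> V"
  have "multi_trace D u j \<in> Vh_on \<Omega> \<T> k (frontier (D j))" for j
    using brokenE[OF u, of j] multi_trace_eq unfolding Vh_on_def by (metis imageI)
  then show ?thesis by (simp add: multi_trace_space_def)
qed

text \<open>An element of \<open>V\<^sub>h\<close> does not vanish on the interfaces, so its representative in the broken space is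
  a different function.  It has the same traces.\<close>

lemma broken_representative:
  assumes "v \<in> V0"
  shows "restr (\<Union>j. D j) v \<in> V" "multi_trace D (restr (\<Union>j. D j) v) = multi_trace D v"
proof -
  have "restr (D j) (restr (\<Union>j. D j) v) = restr (D j) v" for j
    by (auto simp: restr_def fun_eq_iff)
  then show "restr (\<Union>j. D j) v \<in> V"
    using assms by (auto simp: broken_Vh_def Vh_on_def) (auto simp: restr_def)
  show "multi_trace D (restr (\<Union>j. D j) v) = multi_trace D v"
  proof
    fix j
    show "multi_trace D (restr (\<Union>j. D j) v) j = multi_trace D v j"
      by (subst (1 2) multi_trace_eq[OF assms]) (auto simp: restr_def)
  qed
qed

lemma single_trace_space_subset: "single_trace_space \<Omega> \<T> k D \<subseteq> W"
  unfolding single_trace_space_def using broken_representative multi_trace_in by fastforce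

lemma single_trace_space_eq:
  "single_trace_space \<Omega> \<T> k D = (\<lambda>v. multi_trace D (restr (\<Union>j. D j) v)) ` V0"
  unfolding single_trace_space_def using broken_representative(2) by auto

lemma single_trace_space_add:
  "p \<in> single_trace_space \<Omega> \<T> k D \<Longrightarrow> q \<in> single_trace_space \<Omega> \<T> k D \<Longrightarrow> p + q \<in> single_trace_space \<Omega> \<T> k D"
  unfolding single_trace_space_eq
  by (auto simp flip: multi_trace_add[OF broken_representative(1) broken_representative(1)] restr_add
      intro!: imageI cfun.subspace_add[OF subspace_Vh])

lemma single_trace_space_smul:
  "p \<in> single_trace_space \<Omega> \<T> k D \<Longrightarrow> c *\<^sub>c p \<in> single_trace_space \<Omega> \<T> k D"
  unfolding single_trace_space_eq
  by (auto simp flip: multi_trace_cscale[OF broken_representative(1)] restr_cscale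
      intro!: imageI cfun.subspace_scale[OF subspace_Vh])

text \<open>With zero traces from all sides the pieces fit together continuously across the interfaces, where
  the representative is zero by convention.\<close>

lemma zero_trace_in_Vh:
  assumes w: "w \<in> V" and 0: "multi_trace D w = 0"
  shows "w \<in> V0"
proof -
  have rep: "\<exists>v\<in>V0. \<forall>x\<in>closure (D j). w x = v x" for j
  proof -
    obtain v where v: "v \<in> V0" "\<And>x. x \<in> D j \<Longrightarrow> w x = v x" using w brokenE by metis
    have "w x = v x" if x: "x \<in> frontier (D j)" for x
    proof -
      have "x \<notin> (\<Union>i. D i)" using frontier_D_disjoint x by blast
      then have "w x = 0" using w by (simp add: broken_Vh_def)
      moreover have "restr (frontier (D j)) v x = 0"
        using multi_trace_eq[OF v] 0 by (metis zero_fun_apply)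
      ultimately show ?thesis using x by (simp add: restr_def)
    qed
    moreover have "closure (D j) = D j \<union> frontier (D j)" by (simp add: closure_Un_frontier)
    ultimately show ?thesis using v by blast
  qed
  have "continuous_on (closure (D j)) w" for j
    using rep[of j] Vh_continuous closure_D continuous_on_subset continuous_on_cong by metis
  then have "continuous_on (\<Union>j. closure (D j)) w"
    by (intro continuous_on_closed_Union) auto
  moreover have "\<exists>p. poly_fun k p \<and> (\<forall>x\<in>K. w x = p x)" if K: "K \<in> \<T>" for K
  proof -
    obtain j where j: "K \<subseteq> closure (D j)" using cell_in_subdomain K by blast
    obtain v where v: "v \<in> V0" "\<forall>x\<in>closure (D j). w x = v x" using rep by blast
    obtain p where "poly_fun k p" "\<forall>x\<in>K. v x = p x" using v K by (auto simp: Vh_def)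
    then show ?thesis using v j by (metis subsetD)
  qed
  moreover have "w x = 0" if "x \<notin> closure \<Omega>" for x
  proof -
    have "x \<notin> (\<Union>i. D i)" using that D_subset closure_subset by blast
    then show ?thesis using w by (simp add: broken_Vh_def)
  qed
  ultimately show ?thesis by (simp add: Vh_def Union_closure_D)
qed

text \<open>A broken function is determined by its polynomial coefficients on each cell in each subdomain.
  Cells overlap on their faces, so each point is assigned to one chosen cell that contains it; then the
  truncated monomials span.\<close>

lemma broken_Vh_finite_span: "\<exists>G. finite G \<and> V \<subseteq> cfun.span G"
proof -
  \<comment> \<open>The only relevant fact about the chosen cell is that it contains \<open>x\<close>.\<close>
  define sel where "sel x = (SOME K. K \<in> \<T> \<and> x \<in> K)" for x
  define mono :: "('n \<Rightarrow> nat) \<Rightarrow> real^'n \<Rightarrow> complex"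
    where "mono \<alpha> x = complex_of_real (\<Prod>i\<in>UNIV. (x $ i) ^ \<alpha> i)" for \<alpha> x
  let ?I = "{\<alpha> :: 'n \<Rightarrow> nat. (\<Sum>i\<in>UNIV. \<alpha> i) \<le> k}"
  let ?g = "\<lambda>(j, K, \<alpha>). restr {x \<in> D j. sel x = K} (mono \<alpha>)"
  let ?G = "?g ` (UNIV \<times> \<T> \<times> ?I)"
  have "u \<in> cfun.span ?G" if u: "u \<in> V" for u
  proof -
    have "\<exists>v. v \<in> V0 \<and> (\<forall>x\<in>D j. u x = v x)" for j using brokenE[OF u] by metis
    then obtain v where v: "\<And>j. v j \<in> V0" "\<And>j x. x \<in> D j \<Longrightarrow> u x = v j x" by metis
    have "\<exists>c. \<forall>x\<in>K. v j x = (\<Sum>\<alpha>\<in>?I. c \<alpha> * mono \<alpha> x)" if "K \<in> \<T>" for j K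
      using v(1)[of j] that unfolding Vh_def poly_fun_def mono_def by fastforce
    note ex = this
    define c where "c j K = (SOME c. \<forall>x\<in>K. v j x = (\<Sum>\<alpha>\<in>?I. c \<alpha> * mono \<alpha> x))" for j K
    have c: "v j x = (\<Sum>\<alpha>\<in>?I. c j K \<alpha> * mono \<alpha> x)" if "K \<in> \<T>" "x \<in> K" for j K x
      using someI_ex[OF ex[OF that(1), of j]] that(2) unfolding c_def by blast
    have "u = (\<Sum>j\<in>UNIV. \<Sum>K\<in>\<T>. \<Sum>\<alpha>\<in>?I. cscale (c j K \<alpha>) (?g (j, K, \<alpha>)))" (is "u = ?s")
    proof
      fix x
      have s: "?s x = (\<Sum>j\<in>UNIV. \<Sum>K\<in>\<T>. if x \<in> D j \<and> sel x = K then \<Sum>\<alpha>\<in>?I. c j K \<alpha> * mono \<alpha> x else 0)"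
        unfolding sum_fun_apply
      proof (intro sum.cong refl)
        fix j K
        show "(\<Sum>\<alpha>\<in>?I. cscale (c j K \<alpha>) (?g (j, K, \<alpha>)) x)
            = (if x \<in> D j \<and> sel x = K then \<Sum>\<alpha>\<in>?I. c j K \<alpha> * mono \<alpha> x else 0)"
        proof (cases "x \<in> D j \<and> sel x = K")
          case True
          then show ?thesis by (simp add: cscale_def restr_def)
        next
          case False
          then have "restr {x \<in> D j. sel x = K} (mono \<alpha>) x = 0" for \<alpha>
            by (simp only: restr_def mem_Collect_eq if_False)
          then show ?thesis using False by (simp only: cscale_def prod.case mult_zero_right sum.neutral_const if_False)
        qed
      qed
      show "u x = ?s x"
      proof (cases "x \<in> (\<Union>j. D j)")
        case False
        then show ?thesis unfolding s using u by (auto simp: broken_Vh_def)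
      next
        case True
        then obtain i where i: "x \<in> D i" by blast
        then have iff: "x \<in> D j \<longleftrightarrow> j = i" for j using disjoint_D by blast
        have "\<exists>K. K \<in> \<T> \<and> x \<in> K" using Union_mesh D_subset closure_subset i by blast
        then have sel: "sel x \<in> \<T>" "x \<in> sel x" unfolding sel_def by (metis (mono_tags, lifting) someI_ex)+
        have "?s x = (\<Sum>j\<in>UNIV. if j = i then \<Sum>K\<in>\<T>. if sel x = K then \<Sum>\<alpha>\<in>?I. c j K \<alpha> * mono \<alpha> x else 0 else 0)"
          unfolding s iff by (intro sum.cong refl) auto
        also have "\<dots> = (\<Sum>\<alpha>\<in>?I. c i (sel x) \<alpha> * mono \<alpha> x)"
          using finite_mesh sel by simp
        finally show ?thesis using c[OF sel] v(2)[OF i] by simp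
      qed
    qed
    moreover have "?s \<in> cfun.span ?G"
      by (intro cfun.span_sum cfun.span_scale cfun.span_base imageI) auto
    ultimately show ?thesis by simp
  qed
  moreover have "finite ?G" using finite_mesh finite_multi_indices
    by (intro finite_imageI finite_cartesian_product) auto
  ultimately show ?thesis by blast
qed

end

section \<open>Bounded measurable functions and polynomials\<close>

text \<open>An algebra of functions that contains the coefficients and, cell by cell, all factors of the
  integrands, and whose elements are integrable over finite measures.\<close>

definition bounded_measurable :: "'a measure \<Rightarrow> ('a \<Rightarrow> 'b::{real_normed_vector, second_countable_topology}) \<Rightarrow> bool" where
  "bounded_measurable M h \<longleftrightarrow> h \<in> borel_measurable M \<and> (\<exists>B. AE x in M. norm (h x) \<le> B)"

lemma bounded_measurable_const: "bounded_measurable M (\<lambda>x. c)"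
  unfolding bounded_measurable_def by (intro conjI exI[of _ "norm c"] AE_I2) auto

lemma bounded_measurable_add:
  assumes "bounded_measurable M f" "bounded_measurable M g"
  shows "bounded_measurable M (\<lambda>x. f x + g x)"
proof -
  obtain A B where "AE x in M. norm (f x) \<le> A" "AE x in M. norm (g x) \<le> B"
    using assms unfolding bounded_measurable_def by blast
  then have "AE x in M. norm (f x + g x) \<le> A + B"
    by eventually_elim (rule norm_triangle_mono)
  then show ?thesis using assms unfolding bounded_measurable_def by (auto intro: borel_measurable_add)
qed

lemma bounded_measurable_mult:
  fixes f g :: "'a \<Rightarrow> complex"
  assumes "bounded_measurable M f" "bounded_measurable M g"
  shows "bounded_measurable M (\<lambda>x. f x * g x)"
proof -
  obtain A B where "AE x in M. norm (f x) \<le> A" "AE x in M. norm (g x) \<le> B"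
    using assms unfolding bounded_measurable_def by blast
  then have "AE x in M. norm (f x * g x) \<le> A * B"
  proof eventually_elim
    case (elim x)
    then have "0 \<le> A" using norm_ge_zero order_trans by blast
    then show ?case using elim by (simp add: norm_mult mult_mono)
  qed
  then show ?thesis using assms unfolding bounded_measurable_def by auto
qed

lemma bounded_measurable_sum:
  assumes "\<And>i. i \<in> I \<Longrightarrow> bounded_measurable M (f i)"
  shows "bounded_measurable M (\<lambda>x. \<Sum>i\<in>I. f i x)"
  using assms
proof (induction I rule: infinite_finite_induct)
  case (insert i I) then show ?case by (simp add: bounded_measurable_add)
qed (simp_all add: bounded_measurable_const)

lemma bounded_measurable_linear:
  assumes "bounded_linear T" "bounded_measurable M f"
  shows "bounded_measurable M (\<lambda>x. T (f x))"
proof -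
  obtain B where "AE x in M. norm (f x) \<le> B"
    using assms unfolding bounded_measurable_def by blast
  moreover obtain K where "0 \<le> K" "\<And>x. norm (T x) \<le> norm x * K"
    using bounded_linear.nonneg_bounded[OF assms(1)] by blast
  ultimately have "AE x in M. norm (T (f x)) \<le> B * K"
    by (auto elim!: eventually_mono intro: order_trans mult_right_mono)
  moreover have "(\<lambda>x. T (f x)) \<in> borel_measurable M"
    using assms(2) linear_continuous_on[OF assms(1), of UNIV] unfolding bounded_measurable_def
    by (auto intro: measurable_compose borel_measurable_continuous_onI)
  ultimately show ?thesis unfolding bounded_measurable_def by blast
qed

lemmas bounded_measurable_cnj = bounded_measurable_linear[OF bounded_linear_cnj]
  and bounded_measurable_of_real = bounded_measurable_linear[OF bounded_linear_of_real]

lemma bounded_measurable_restrict_space: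
  assumes "bounded_measurable M h" "A \<in> sets M"
  shows "bounded_measurable (restrict_space M A) h"
  using assms sets.sets_into_space[OF assms(2)] unfolding bounded_measurable_def
  by (auto simp: AE_restrict_space_iff measurable_restrict_space1 Int_absorb2)

lemma bounded_measurable_cong:
  "(\<And>x. x \<in> space M \<Longrightarrow> f x = g x) \<Longrightarrow> bounded_measurable M f \<longleftrightarrow> bounded_measurable M g"
  unfolding bounded_measurable_def
  by (simp cong: measurable_cong AE_cong)

lemma (in finite_measure) bounded_measurable_integrable:
  fixes h :: "'a \<Rightarrow> complex"
  shows "bounded_measurable M h \<Longrightarrow> integrable M h"
  unfolding bounded_measurable_def using integrable_const_bound by blast

lemma integrable_mult_bounded_measurable:
  fixes f h :: "'a \<Rightarrow> complex"
  assumes f: "integrable M f" and h: "bounded_measurable M h"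
  shows "integrable M (\<lambda>x. f x * h x)"
proof -
  obtain B where B: "AE x in M. norm (h x) \<le> B" using h unfolding bounded_measurable_def by blast
  show ?thesis
  proof (rule Bochner_Integration.integrable_bound)
    show "integrable M (\<lambda>x. f x * of_real B)" using f by simp
    show "(\<lambda>x. f x * h x) \<in> borel_measurable M"
      using f h unfolding bounded_measurable_def by auto
    show "AE x in M. norm (f x * h x) \<le> norm (f x * of_real B)"
      using B by eventually_elim (auto simp: norm_mult intro!: mult_left_mono)
  qed
qed

lemma continuous_bounded_measurable:
  fixes h :: "'a::topological_space \<Rightarrow> 'b::{real_normed_vector, second_countable_topology}"
  assumes h: "continuous_on C h" "compact C" and A: "A \<subseteq> C" "A \<in> sets M" and M: "sets borel \<subseteq> sets M" "space M = UNIV"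
  shows "bounded_measurable (restrict_space M A) h"
proof -
  obtain B where B: "\<forall>x\<in>C. norm (h x) \<le> B"
    using compact_imp_bounded[OF compact_continuous_image[OF h]] by (auto simp: bounded_iff)
  have "h \<in> borel_measurable (restrict_space borel A)"
    using borel_measurable_continuous_on_restrict continuous_on_subset[OF h(1) A(1)] by blast
  moreover have "sets (restrict_space borel A) \<subseteq> sets (restrict_space M A)"
    using M(1) by (auto simp: sets_restrict_space)
  ultimately have "h \<in> borel_measurable (restrict_space M A)"
    using measurable_mono[of borel borel "restrict_space borel A" "restrict_space M A"] M(2)
    by (auto simp: space_restrict_space)
  moreover have "AE x in restrict_space M A. norm (h x) \<le> B"
    using A B M by (auto simp: AE_restrict_space_iff intro!: AE_I2)
  ultimately show ?thesis unfolding bounded_measurable_def by blast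
qed

text \<open>From \<open>2 \<bar>h\<bar> \<le> 1 + \<bar>h\<bar>\<^sup>2\<close>.\<close>

lemma L2_fun_integrable:
  assumes "L2_fun M h" "finite_measure M"
  shows "integrable M h"
proof (rule Bochner_Integration.integrable_bound)
  interpret finite_measure M by fact
  show "integrable M (\<lambda>x. 1 + (cmod (h x))\<^sup>2)"
    using assms(1) by (auto simp: L2_fun_def)
  show "AE x in M. norm (h x) \<le> norm (1 + (cmod (h x))\<^sup>2)"
  proof (rule AE_I2)
    fix x
    have "0 \<le> (cmod (h x) - 1)\<^sup>2" by simp
    then have "2 * cmod (h x) \<le> 1 + (cmod (h x))\<^sup>2" by (simp add: power2_eq_square algebra_simps)
    then have "cmod (h x) \<le> 1 + (cmod (h x))\<^sup>2" using norm_ge_zero[of "h x"] by linarith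
    then show "norm (h x) \<le> norm (1 + (cmod (h x))\<^sup>2)" by simp
  qed
qed (use assms in \<open>auto simp: L2_fun_def\<close>)

lemma esssup_finite_AE_bounded:
  assumes "esssup M (\<lambda>x. ereal (norm (h x))) < \<infinity>"
  shows "\<exists>B. AE x in M. norm (h x) \<le> B"
proof -
  obtain B :: real where B: "esssup M (\<lambda>x. ereal (norm (h x))) \<le> ereal B"
    using assms by (metis less_PInf_Ex_of_nat linorder_not_less order_less_imp_le)
  have "AE x in M. ereal (norm (h x)) \<le> esssup M (\<lambda>x. ereal (norm (h x)))" by (rule esssup_AE)
  then have "AE x in M. norm (h x) \<le> B"
    by eventually_elim (use B order_trans in fastforce)
  then show ?thesis by blast
qed

text \<open>Continuity of the derivative is only required in each fixed direction, which is all that partial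
  derivatives need.\<close>

definition C1 :: "(real^'n \<Rightarrow> complex) set" where
  "C1 = {f. \<exists>f'. (\<forall>x. (f has_derivative f' x) (at x)) \<and> (\<forall>v. continuous_on UNIV (\<lambda>x. f' x v))}"

lemma C1_continuous: "f \<in> C1 \<Longrightarrow> continuous_on UNIV f"
  unfolding C1_def using has_derivative_continuous by (blast intro: continuous_at_imp_continuous_on)

lemma C1_const: "(\<lambda>x. c) \<in> C1"
  unfolding C1_def by (auto intro!: exI[of _ "\<lambda>x v. 0"])

lemma C1_coordinate:
  fixes i :: "'n::finite"
  shows "(\<lambda>x. complex_of_real (x $ i)) \<in> C1"
proof -
  have "bounded_linear (\<lambda>x::real^'n. complex_of_real (x $ i))"
    by (rule bounded_linear_compose[OF bounded_linear_of_real bounded_linear_vec_nth])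
  then show ?thesis unfolding C1_def
    using bounded_linear_imp_has_derivative
    by (intro CollectI exI[of _ "\<lambda>x v. complex_of_real (v $ i)"]) auto
qed

lemma C1_add: "f \<in> C1 \<Longrightarrow> g \<in> C1 \<Longrightarrow> (\<lambda>x. f x + g x) \<in> C1"
proof -
  assume "f \<in> C1" "g \<in> C1"
  then obtain f' g' where "\<And>x. (f has_derivative f' x) (at x)" "\<And>v. continuous_on UNIV (\<lambda>x. f' x v)"
    "\<And>x. (g has_derivative g' x) (at x)" "\<And>v. continuous_on UNIV (\<lambda>x. g' x v)"
    unfolding C1_def by blast
  then show ?thesis unfolding C1_def
    by (intro CollectI exI[of _ "\<lambda>x v. f' x v + g' x v"] conjI allI has_derivative_add continuous_on_add)
qed

lemma C1_mult: "f \<in> C1 \<Longrightarrow> g \<in> C1 \<Longrightarrow> (\<lambda>x. f x * g x) \<in> C1"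
proof -
  assume fg: "f \<in> C1" "g \<in> C1"
  then obtain f' g' where "\<And>x. (f has_derivative f' x) (at x)" "\<And>v. continuous_on UNIV (\<lambda>x. f' x v)"
    "\<And>x. (g has_derivative g' x) (at x)" "\<And>v. continuous_on UNIV (\<lambda>x. g' x v)"
    unfolding C1_def by blast
  then show ?thesis unfolding C1_def
    by (intro CollectI exI[of _ "\<lambda>x v. f x * g' x v + f' x v * g x"] conjI allI has_derivative_mult
        continuous_on_add continuous_on_mult C1_continuous[OF fg(1)] C1_continuous[OF fg(2)])
qed

lemma C1_power: "f \<in> C1 \<Longrightarrow> (\<lambda>x. f x ^ m) \<in> C1"
  by (induction m) (auto intro: C1_const C1_mult)

lemma C1_prod: "(\<And>i. i \<in> I \<Longrightarrow> f i \<in> C1) \<Longrightarrow> (\<lambda>x. \<Prod>i\<in>I. f i x) \<in> C1"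
  by (induction I rule: infinite_finite_induct) (auto intro: C1_const C1_mult)

lemma C1_sum: "(\<And>i. i \<in> I \<Longrightarrow> f i \<in> C1) \<Longrightarrow> (\<lambda>x. \<Sum>i\<in>I. f i x) \<in> C1"
  by (induction I rule: infinite_finite_induct) (auto intro: C1_const C1_add)

lemma poly_fun_C1: "poly_fun k p \<Longrightarrow> p \<in> C1"
  unfolding poly_fun_def of_real_prod of_real_power
  by (auto intro!: C1_sum C1_mult C1_const C1_prod C1_power C1_coordinate)

lemma C1_differentiable: "f \<in> C1 \<Longrightarrow> f differentiable (at x)"
  unfolding C1_def differentiable_def by blast

lemma C1_continuous_partial_deriv: "f \<in> C1 \<Longrightarrow> continuous_on UNIV (partial_deriv i f)"
proof -
  assume "f \<in> C1"
  then obtain f' where f': "\<And>x. (f has_derivative f' x) (at x)" "\<And>v. continuous_on UNIV (\<lambda>x. f' x v)"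
    unfolding C1_def by blast
  have "partial_deriv i f = (\<lambda>x. f' x (axis i 1))"
    unfolding partial_deriv_def frechet_derivative_at[OF f'(1), symmetric] ..
  then show ?thesis using f'(2) by simp
qed

lemma partial_deriv_cong_open:
  assumes "open S" "x \<in> S" "\<And>y. y \<in> S \<Longrightarrow> u y = v y" "v differentiable (at x)"
  shows "u differentiable (at x)" "partial_deriv i u x = partial_deriv i v x"
proof -
  obtain v' where v': "(v has_derivative v') (at x)" using assms(4) unfolding differentiable_def by blast
  then have u': "(u has_derivative v') (at x)"
    by (rule has_derivative_transform_within_open[OF _ assms(1,2)]) (use assms(3) in auto)
  show "u differentiable (at x)" using u' unfolding differentiable_def by blast
  show "partial_deriv i u x = partial_deriv i v x"
    unfolding partial_deriv_def using frechet_derivative_at[OF u'] frechet_derivative_at[OF v'] by simp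
qed

lemma partial_deriv_add:
  assumes "u differentiable (at x)" "v differentiable (at x)"
  shows "partial_deriv i (u + v) x = partial_deriv i u x + partial_deriv i v x"
proof -
  have "((u + v) has_derivative (\<lambda>h. frechet_derivative u (at x) h + frechet_derivative v (at x) h)) (at x)"
    unfolding plus_fun_def using assms by (intro has_derivative_add) (simp_all add: frechet_derivative_works)
  then show ?thesis unfolding partial_deriv_def by (simp flip: frechet_derivative_at)
qed

lemma partial_deriv_cscale:
  assumes "u differentiable (at x)"
  shows "partial_deriv i (cscale c u) x = c * partial_deriv i u x"
proof -
  have "(cscale c u has_derivative (\<lambda>h. c * frechet_derivative u (at x) h)) (at x)"
    unfolding cscale_def using assms by (intro has_derivative_mult_right) (simp add: frechet_derivative_works)
  then show ?thesis unfolding partial_deriv_def by (simp flip: frechet_derivative_at)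
qed

section \<open>Integrals over subdomains and their boundaries\<close>

context decomposed_mesh begin

lemma compact_closure_\<Omega>: "compact (closure \<Omega>)"
  using bounded_\<Omega> by (simp add: compact_closure)

lemma D_borel: "D j \<in> sets borel"
  using open_D by auto

lemma sets_surface: "sets borel \<subseteq> sets (surface_measure \<Omega> \<T>)"
  and space_surface: "space (surface_measure \<Omega> \<T>) = UNIV"
proof -
  have "sets (borel_surface_measure \<Omega> \<T>) = sets borel" "space (borel_surface_measure \<Omega> \<T>) = UNIV"
    unfolding borel_surface_measure_def
    using sets.sigma_sets_eq[of "borel :: (real^'n) measure"] by (simp_all add: sets_measure_of space_measure_of)
  then show "sets borel \<subseteq> sets (surface_measure \<Omega> \<T>)" "space (surface_measure \<Omega> \<T>) = UNIV"
    unfolding surface_measure_def by (auto simp del: emeasure_completion)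
qed

text \<open>Each prism over a facet is bounded, because facets lie in the bounded set
  \<open>frontier \<Omega>\<close> and normals have length 1.\<close>

lemma finite_surface_measure: "finite_measure (surface_measure \<Omega> \<T>)"
proof
  have sets: "sets (borel_surface_measure \<Omega> \<T>) = sets borel"
    unfolding borel_surface_measure_def
    using sets.sigma_sets_eq[of "borel :: (real^'n) measure"] by (simp add: sets_measure_of)
  have "emeasure lborel (prism F UNIV) < \<infinity>" if F: "F \<in> boundary_facets \<Omega> \<T>" for F
  proof -
    obtain K where K: "F facet_of K" using F by (auto simp: boundary_facets_def)
    obtain B where B: "\<And>x. x \<in> F \<Longrightarrow> norm x \<le> B"
      using F bounded_subset[OF bounded_closure[OF bounded_\<Omega>]]
      by (metis (no_types, lifting) boundary_facets_def bounded_iff Diff_subset frontier_def mem_Collect_eq subset_trans)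
    have "prism F UNIV \<subseteq> cball 0 (B + 1)"
    proof
      fix y assume "y \<in> prism F UNIV"
      then obtain x s where *: "y = x + s *\<^sub>R facet_normal F" "x \<in> F" "0 \<le> s" "s \<le> 1"
        by (auto simp: prism_def)
      have "norm y \<le> norm x + norm (s *\<^sub>R facet_normal F)"
        unfolding *(1) by (rule norm_triangle_ineq)
      also have "\<dots> \<le> B + 1" using B[OF *(2)] * facet_normal[OF K] by (simp add: add_mono)
      finally show "y \<in> cball 0 (B + 1)" by simp
    qed
    then show ?thesis by (intro emeasure_bounded_finite bounded_subset[OF bounded_cball])
  qed
  then have "emeasure (borel_surface_measure \<Omega> \<T>) UNIV < \<infinity>"
    by (cases "finite (boundary_facets \<Omega> \<T>)") (simp_all add: emeasure_borel_surface_measure[OF mesh] ennreal_sum_less_top)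
  moreover have "emeasure (surface_measure \<Omega> \<T>) UNIV = emeasure (borel_surface_measure \<Omega> \<T>) UNIV"
    unfolding surface_measure_def using sets by (simp add: main_part)
  ultimately show "emeasure (surface_measure \<Omega> \<T>) (space (surface_measure \<Omega> \<T>)) \<noteq> \<infinity>"
    by (simp add: space_surface)
qed

lemma negligible_skeleton: "negligible (\<Union>K\<in>\<T>. frontier K)"
  using finite_mesh simplex_mesh convex_simplex negligible_convex_frontier
  by (intro negligible_Union) auto

lemma off_skeleton:
  assumes "x \<in> D j" "x \<notin> (\<Union>K\<in>\<T>. frontier K)"
  obtains K where "K \<in> \<T>" "x \<in> D j \<inter> interior K"
proof -
  obtain K where "K \<in> \<T>" "x \<in> K" using assms D_subset closure_subset Union_mesh by blast
  moreover then have "x \<in> interior K"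
    using assms closed_simplex[OF simplex_mesh] by (auto simp: frontier_def)
  ultimately show ?thesis using assms that by blast
qed

text \<open>Up to the mesh skeleton, a null set, a subdomain is covered by the interiors of finitely many
  cells.\<close>

lemma integrable_on_D:
  fixes h :: "real^'n \<Rightarrow> complex"
  assumes "\<And>K. K \<in> \<T> \<Longrightarrow> integrable (lebesgue_on (D j \<inter> interior K)) h"
  shows "integrable (lebesgue_on (D j)) h"
proof -
  have "h absolutely_integrable_on (\<Union>K\<in>\<T>. D j \<inter> interior K)"
    using finite_mesh assms open_D
    by (intro set_integrable_UN) (auto simp: set_integrable_def integrable_restrict_space open_Int)
  then have "h absolutely_integrable_on D j"
  proof (rule absolutely_integrable_spike_set)
    show "negligible {x \<in> D j - (\<Union>K\<in>\<T>. D j \<inter> interior K). h x \<noteq> 0}"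
      using off_skeleton by (intro negligible_subset[OF negligible_skeleton]) blast
    show "negligible {x \<in> (\<Union>K\<in>\<T>. D j \<inter> interior K) - D j. h x \<noteq> 0}"
      by (rule negligible_subset[OF negligible_empty]) auto
  qed
  then show ?thesis
    using D_borel by (simp add: set_integrable_def integrable_restrict_space)
qed

text \<open>On the open set \<open>D j \<inter> interior K\<close> a broken function is a polynomial, which is continuously
  differentiable and has bounded derivatives on the compact cell \<open>K\<close>.\<close>

lemma broken_on_cell:
  assumes u: "u \<in> V" and K: "K \<in> \<T>"
  shows "bounded_measurable (lebesgue_on (D j \<inter> interior K)) u"
    and "bounded_measurable (lebesgue_on (D j \<inter> interior K)) (partial_deriv i u)"
    and "x \<in> D j \<inter> interior K \<Longrightarrow> u differentiable (at x)"
proof -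
  let ?S = "D j \<inter> interior K"
  obtain v where v: "v \<in> V0" "\<And>x. x \<in> D j \<Longrightarrow> u x = v x" using u brokenE by metis
  obtain p where p: "poly_fun k p" "\<forall>x\<in>K. v x = p x" using v K by (auto simp: Vh_def)
  have up: "u x = p x" if "x \<in> ?S" for x using v p that interior_subset by fastforce
  have S: "open ?S" using open_D by auto
  note p1 = poly_fun_C1[OF p(1)]
  note cong = partial_deriv_cong_open[OF S _ up C1_differentiable[OF p1]]
  show "u differentiable (at x)" if "x \<in> ?S" using cong that by blast
  have bm: "bounded_measurable (lebesgue_on ?S) q" if "continuous_on UNIV q" for q :: "real^'n \<Rightarrow> complex"
  proof (rule continuous_bounded_measurable)
    show "continuous_on K q" using that continuous_on_subset by blast
    show "compact K" using simplex_mesh[OF K] compact_simplex by blast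
    show "?S \<subseteq> K" using interior_subset by blast
  qed (use S in auto)
  show "bounded_measurable (lebesgue_on ?S) u"
    using bm[OF C1_continuous[OF p1]] up by (subst bounded_measurable_cong[of _ _ p]) auto
  show "bounded_measurable (lebesgue_on ?S) (partial_deriv i u)"
    using bm[OF C1_continuous_partial_deriv[OF p1]] cong
    by (subst bounded_measurable_cong[of _ _ "partial_deriv i p"]) auto
qed

lemma AE_differentiable:
  "u \<in> V \<Longrightarrow> AE x in lebesgue_on (D j). u differentiable (at x)"
proof -
  assume u: "u \<in> V"
  have "AE x in lebesgue. x \<notin> (\<Union>K\<in>\<T>. frontier K)"
    using AE_not_in negligible_skeleton unfolding negligible_iff_null_sets by blast
  then have "AE x in lebesgue. x \<in> D j \<longrightarrow> u differentiable (at x)"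
    by eventually_elim (metis off_skeleton broken_on_cell(3)[OF u])
  then show ?thesis using D_borel by (simp add: AE_restrict_space_iff)
qed

lemma broken_bounded_measurable: "u \<in> V \<Longrightarrow> bounded_measurable (lebesgue_on (D j)) u"
proof -
  assume "u \<in> V"
  then obtain v where v: "v \<in> V0" "\<And>x. x \<in> D j \<Longrightarrow> u x = v x" using brokenE by metis
  have "bounded_measurable (lebesgue_on (D j)) v"
    by (rule continuous_bounded_measurable[OF Vh_continuous[OF v(1)] compact_closure_\<Omega>])
      (use D_subset closure_subset D_borel in auto)
  then show ?thesis using v(2) by (subst bounded_measurable_cong[of _ _ v]) auto
qed

abbreviation "\<Gamma> j \<equiv> frontier (D j) \<inter> frontier \<Omega>"
abbreviation "\<sigma> \<equiv> surface_measure \<Omega> \<T>"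

lemma \<Gamma>_sets: "\<Gamma> j \<in> sets \<sigma>" and frontier_sets: "frontier \<Omega> \<in> sets \<sigma>"
  using sets_surface borel_closed[OF frontier_closed] borel_closed[OF closed_Int[OF frontier_closed frontier_closed]]
  by blast+

lemma finite_measure_\<Gamma>: "finite_measure (restrict_space \<sigma> (\<Gamma> j))"
  using finite_measure_restrict_space[OF finite_surface_measure \<Gamma>_sets] .

lemma set_integral_\<Gamma>: "(LINT x : \<Gamma> j | \<sigma>. h x) = (\<integral>x. h x \<partial>restrict_space \<sigma> (\<Gamma> j))"
  for h :: "real^'n \<Rightarrow> complex"
  using \<Gamma>_sets space_surface by (simp add: set_lebesgue_integral_def integral_restrict_space)

lemma trace_bounded_measurable:
  "u \<in> V \<Longrightarrow> bounded_measurable (restrict_space \<sigma> (\<Gamma> j)) (trace_from (D j) u)"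
proof -
  assume "u \<in> V"
  then obtain v where v: "v \<in> V0" "\<And>x. x \<in> D j \<Longrightarrow> u x = v x" using brokenE by metis
  have "bounded_measurable (restrict_space \<sigma> (\<Gamma> j)) v"
    by (rule continuous_bounded_measurable[OF Vh_continuous[OF v(1)] compact_closure_\<Omega>])
      (use frontier_D \<Gamma>_sets sets_surface space_surface in auto)
  then show ?thesis using trace_from_eq[OF v]
    by (subst bounded_measurable_cong[of _ _ v]) (auto simp: space_restrict_space)
qed

lemma restrict_D: "lebesgue_on (D j) = restrict_space (lebesgue_on \<Omega>) (D j)" "D j \<in> sets (lebesgue_on \<Omega>)"
  using D_subset open_\<Omega> D_borel
  by (auto simp: restrict_restrict_space Int_absorb1 sets_restrict_space_iff)

lemma restrict_\<Gamma>: "restrict_space \<sigma> (\<Gamma> j) = restrict_space (restrict_space \<sigma> (frontier \<Omega>)) (\<Gamma> j)"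
    "\<Gamma> j \<in> sets (restrict_space \<sigma> (frontier \<Omega>))"
  using frontier_sets \<Gamma>_sets space_surface
  by (auto simp: restrict_restrict_space Int_absorb1 sets_restrict_space_iff)

end

section \<open>The Helmholtz form\<close>

text \<open>No sign is imposed on \<open>\<kappa>\<close> here, so that the results also apply to the adjoint form, whose
  coefficient is \<open>- cnj \<kappa>\<close>.\<close>

locale helmholtz_form = decomposed_mesh \<Omega> \<T> k D
  for \<Omega> :: "(real^'n) set" and \<T> :: "(real^'n) set set" and k :: nat
    and D :: "'j::finite \<Rightarrow> (real^'n) set" +
  fixes \<kappa> :: "real^'n \<Rightarrow> complex" and \<mu> :: "real^'n \<Rightarrow> real"
  assumes kappa_volume: "bounded_measurable (lebesgue_on \<Omega>) \<kappa>"
    and mu_volume: "bounded_measurable (lebesgue_on \<Omega>) \<mu>"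
    and kappa_surface: "bounded_measurable (restrict_space (surface_measure \<Omega> \<T>) (frontier \<Omega>)) \<kappa>"
begin

abbreviation "a \<equiv> form_a \<Omega> \<T> D \<kappa> \<mu>"

definition volume_integrand :: "(real^'n \<Rightarrow> complex) \<Rightarrow> (real^'n \<Rightarrow> complex) \<Rightarrow> real^'n \<Rightarrow> complex" where
  "volume_integrand u v x = of_real (\<mu> x) * (\<Sum>i\<in>UNIV. partial_deriv i u x * cnj (partial_deriv i v x))
     - (\<kappa> x)\<^sup>2 * u x * cnj (v x)"

definition surface_integrand :: "'j \<Rightarrow> (real^'n \<Rightarrow> complex) \<Rightarrow> (real^'n \<Rightarrow> complex) \<Rightarrow> real^'n \<Rightarrow> complex" where
  "surface_integrand j u v x = \<kappa> x * trace_from (D j) u x * cnj (trace_from (D j) v x)"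

lemma form_a_eq: "a u v = (\<Sum>j\<in>UNIV. (\<integral>x. volume_integrand u v x \<partial>lebesgue_on (D j))
    - \<i> * (\<integral>x. surface_integrand j u v x \<partial>restrict_space \<sigma> (\<Gamma> j)))"
  unfolding form_a_def set_integral_\<Gamma> volume_integrand_def surface_integrand_def ..

lemma volume_integrable:
  assumes "u \<in> V" "v \<in> V"
  shows "integrable (lebesgue_on (D j)) (volume_integrand u v)"
proof (rule integrable_on_D)
  fix K assume K: "K \<in> \<T>"
  let ?S = "D j \<inter> interior K"
  have S: "?S \<in> lmeasurable" "?S \<in> sets (lebesgue_on \<Omega>)" "?S \<subseteq> \<Omega>"
    using lmeasurable_open[OF bounded_subset[OF bounded_\<Omega>], of ?S] D_subset[of j] open_D[of j] open_\<Omega>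
    by (auto simp: sets_restrict_space_iff open_Int)
  have bm: "bounded_measurable (lebesgue_on ?S) h" if "bounded_measurable (lebesgue_on \<Omega>) h"
    for h :: "real^'n \<Rightarrow> 'b::{real_normed_vector, second_countable_topology}"
    using bounded_measurable_restrict_space[OF that S(2)] S open_\<Omega>
    by (simp add: restrict_restrict_space Int_absorb1 fmeasurableD)
  have "bounded_measurable (lebesgue_on ?S) (\<lambda>x. of_real (\<mu> x) *
      (\<Sum>i\<in>UNIV. partial_deriv i u x * cnj (partial_deriv i v x)) + (- 1) * (\<kappa> x * \<kappa> x * u x * cnj (v x)))"
    by (intro bounded_measurable_add bounded_measurable_mult bounded_measurable_sum bounded_measurable_cnj
        bounded_measurable_const bounded_measurable_of_real bm kappa_volume mu_volume
        broken_on_cell(1,2)[OF assms(1) K] broken_on_cell(1,2)[OF assms(2) K])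
  then show "integrable (lebesgue_on ?S) (volume_integrand u v)"
    using finite_measure.bounded_measurable_integrable[OF finite_measure_lebesgue_on[OF S(1)]]
    unfolding volume_integrand_def by (simp add: power2_eq_square)
qed

lemma surface_integrable:
  assumes "u \<in> V" "v \<in> V"
  shows "integrable (restrict_space \<sigma> (\<Gamma> j)) (surface_integrand j u v)"
proof -
  have "bounded_measurable (restrict_space \<sigma> (\<Gamma> j)) \<kappa>"
    unfolding restrict_\<Gamma>(1) by (rule bounded_measurable_restrict_space[OF kappa_surface restrict_\<Gamma>(2)])
  then have "bounded_measurable (restrict_space \<sigma> (\<Gamma> j)) (surface_integrand j u v)"
    unfolding surface_integrand_def
    by (intro bounded_measurable_mult bounded_measurable_cnj trace_bounded_measurable assms)
  then show ?thesis
    by (rule finite_measure.bounded_measurable_integrable[OF finite_measure_\<Gamma>])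
qed

lemma form_a_add_left:
  assumes "u \<in> V" "u' \<in> V" "v \<in> V"
  shows "a (u + u') v = a u v + a u' v"
proof -
  have sum: "u + u' \<in> V" using assms cfun.subspace_add[OF subspace_broken_Vh] by blast
  have vol: "(\<integral>x. volume_integrand (u + u') v x \<partial>lebesgue_on (D j))
      = (\<integral>x. volume_integrand u v x \<partial>lebesgue_on (D j)) + (\<integral>x. volume_integrand u' v x \<partial>lebesgue_on (D j))" for j
  proof -
    have "(\<integral>x. volume_integrand (u + u') v x \<partial>lebesgue_on (D j))
        = (\<integral>x. volume_integrand u v x + volume_integrand u' v x \<partial>lebesgue_on (D j))"
    proof (rule integral_cong_AE)
      show "AE x in lebesgue_on (D j). volume_integrand (u + u') v x = volume_integrand u v x + volume_integrand u' v x"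
        using AE_differentiable[OF assms(1), of j] AE_differentiable[OF assms(2), of j]
        by eventually_elim
          (simp add: volume_integrand_def partial_deriv_add distrib_left distrib_right sum.distrib algebra_simps)
    qed (intro borel_measurable_integrable Bochner_Integration.integrable_add volume_integrable assms sum)+
    then show ?thesis using volume_integrable assms by (simp add: Bochner_Integration.integral_add)
  qed
  have surf: "(\<integral>x. surface_integrand j (u + u') v x \<partial>restrict_space \<sigma> (\<Gamma> j))
      = (\<integral>x. surface_integrand j u v x \<partial>restrict_space \<sigma> (\<Gamma> j))
        + (\<integral>x. surface_integrand j u' v x \<partial>restrict_space \<sigma> (\<Gamma> j))" for j
  proof -
    have "(\<integral>x. surface_integrand j (u + u') v x \<partial>restrict_space \<sigma> (\<Gamma> j))
        = (\<integral>x. surface_integrand j u v x + surface_integrand j u' v x \<partial>restrict_space \<sigma> (\<Gamma> j))"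
      using assms
      by (intro Bochner_Integration.integral_cong refl)
        (auto simp: surface_integrand_def trace_from_add space_restrict_space algebra_simps)
    then show ?thesis using surface_integrable assms by (simp add: Bochner_Integration.integral_add)
  qed
  show ?thesis unfolding form_a_eq vol surf by (simp add: sum.distrib[symmetric] algebra_simps)
qed

lemma form_a_cscale_left:
  assumes "u \<in> V" "v \<in> V"
  shows "a (cscale c u) v = c * a u v"
proof -
  have scale: "cscale c u \<in> V" using assms cfun.subspace_scale[OF subspace_broken_Vh] by blast
  have vol: "(\<integral>x. volume_integrand (cscale c u) v x \<partial>lebesgue_on (D j))
      = c * (\<integral>x. volume_integrand u v x \<partial>lebesgue_on (D j))" for j
  proof -
    have "(\<integral>x. volume_integrand (cscale c u) v x \<partial>lebesgue_on (D j))
        = (\<integral>x. c * volume_integrand u v x \<partial>lebesgue_on (D j))"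
    proof (rule integral_cong_AE)
      show "AE x in lebesgue_on (D j). volume_integrand (cscale c u) v x = c * volume_integrand u v x"
        using AE_differentiable[OF assms(1), of j]
        by eventually_elim
          (simp add: volume_integrand_def partial_deriv_cscale sum_distrib_left algebra_simps, simp add: cscale_def)
    qed (intro borel_measurable_integrable integrable_mult_right volume_integrable assms scale)+
    then show ?thesis by simp
  qed
  have surf: "(\<integral>x. surface_integrand j (cscale c u) v x \<partial>restrict_space \<sigma> (\<Gamma> j))
      = c * (\<integral>x. surface_integrand j u v x \<partial>restrict_space \<sigma> (\<Gamma> j))" for j
  proof -
    have "(\<integral>x. surface_integrand j (cscale c u) v x \<partial>restrict_space \<sigma> (\<Gamma> j))
        = (\<integral>x. c * surface_integrand j u v x \<partial>restrict_space \<sigma> (\<Gamma> j))"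
      using assms
      by (intro Bochner_Integration.integral_cong refl)
        (auto simp: surface_integrand_def trace_from_cscale space_restrict_space algebra_simps)
    then show ?thesis by simp
  qed
  show ?thesis unfolding form_a_eq vol surf by (simp add: sum_distrib_left algebra_simps)
qed

lemma form_a_left: "v \<in> V \<Longrightarrow> linear_functional_on V (\<lambda>u. a u v)"
  by (simp add: linear_functional_on_def form_a_add_left form_a_cscale_left)

text \<open>Since \<open>(- cnj \<kappa>)\<^sup>2 = cnj (\<kappa>\<^sup>2)\<close>, replacing \<open>\<kappa>\<close> by \<open>- cnj \<kappa>\<close> conjugates the coefficient of the volume
  term, and in the boundary term the minus sign compensates \<open>cnj \<i> = - \<i>\<close>.  Antilinearity in the
  second argument thus follows from linearity in the first.\<close>

lemma form_a_adjoint: "form_a \<Omega> \<T> D (\<lambda>x. - cnj (\<kappa> x)) \<mu> v u = cnj (a u v)"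
proof -
  have vol: "(\<integral>x. of_real (\<mu> x) * (\<Sum>i\<in>UNIV. partial_deriv i v x * cnj (partial_deriv i u x))
        - (- cnj (\<kappa> x))\<^sup>2 * v x * cnj (u x) \<partial>lebesgue_on (D j))
      = cnj (\<integral>x. volume_integrand u v x \<partial>lebesgue_on (D j))" for j
    unfolding Bochner_Integration.integral_cnj[symmetric]
    by (intro Bochner_Integration.integral_cong refl) (simp add: volume_integrand_def mult_ac)
  have surf: "(\<integral>x. - cnj (\<kappa> x) * trace_from (D j) v x * cnj (trace_from (D j) u x) \<partial>restrict_space \<sigma> (\<Gamma> j))
      = - cnj (\<integral>x. surface_integrand j u v x \<partial>restrict_space \<sigma> (\<Gamma> j))" for j
    unfolding Bochner_Integration.integral_cnj[symmetric] Bochner_Integration.integral_minus[symmetric]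
    by (intro Bochner_Integration.integral_cong refl) (simp add: surface_integrand_def mult_ac)
  show ?thesis
    unfolding form_a_eq unfolding form_a_def set_integral_\<Gamma> vol surf by simp
qed

lemma form_a_right: "u \<in> V \<Longrightarrow> antilinear_on V (a u)"
proof -
  assume u: "u \<in> V"
  interpret adj: helmholtz_form \<Omega> \<T> k D "\<lambda>x. - cnj (\<kappa> x)" \<mu>
  proof
    have "bounded_linear (\<lambda>z. - cnj z)" by (intro bounded_linear_minus bounded_linear_cnj)
    note this[THEN bounded_measurable_linear]
    then show "bounded_measurable (lebesgue_on \<Omega>) (\<lambda>x. - cnj (\<kappa> x))"
      "bounded_measurable (restrict_space \<sigma> (frontier \<Omega>)) (\<lambda>x. - cnj (\<kappa> x))"
      using kappa_volume kappa_surface by blast+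
  qed (rule mu_volume)
  have "a u v = cnj (form_a \<Omega> \<T> D (\<lambda>x. - cnj (\<kappa> x)) \<mu> v u)" for v
    using form_a_adjoint[of v u] by simp
  then show ?thesis
    using adj.form_a_left[OF u] by (auto simp: linear_functional_on_def antilinear_on_def)
qed

text \<open>Derivatives at points of the open sets \<open>D j\<close> and interior traces only see the values in
  \<open>D j\<close>.\<close>

lemma form_a_broken_representative:
  "a u (restr (\<Union>j. D j) v) = a u v"
proof -
  have 1: "partial_deriv i (restr (\<Union>j. D j) v) x = partial_deriv i v x" if x: "x \<in> D j" for i x j
  proof -
    have "(restr (\<Union>j. D j) v has_derivative h) (at x) \<longleftrightarrow> (v has_derivative h) (at x)" for h
    proof
      assume "(restr (\<Union>j. D j) v has_derivative h) (at x)"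
      then show "(v has_derivative h) (at x)"
        by (rule has_derivative_transform_within_open[OF _ open_D x]) (auto simp: restr_def)
    next
      assume "(v has_derivative h) (at x)"
      then show "(restr (\<Union>j. D j) v has_derivative h) (at x)"
        by (rule has_derivative_transform_within_open[OF _ open_D x]) (auto simp: restr_def)
    qed
    then show ?thesis by (simp add: partial_deriv_def frechet_derivative_def)
  qed
  have 2: "trace_from (D j) (restr (\<Union>j. D j) v) x = trace_from (D j) v x" for j x
  proof -
    have "(restr (\<Union>j. D j) v \<longlongrightarrow> l) (at x within D j) \<longleftrightarrow> (v \<longlongrightarrow> l) (at x within D j)" for l
      by (rule Lim_cong_within) (auto simp: restr_def)
    then show ?thesis by (simp add: trace_from_def Topological_Spaces.Lim_def)
  qed
  have 3: "restr (\<Union>j. D j) v x = v x" if "x \<in> D j" for x j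
    using that by (auto simp: restr_def)
  show ?thesis
    unfolding form_a_def 2
    by (intro sum.cong refl arg_cong2[where f = "(-)"] Bochner_Integration.integral_cong)
      (auto simp: 1 3)
qed

end

locale dissipative_form = helmholtz_form +
  assumes kappa_sign_volume: "x \<in> \<Omega> \<Longrightarrow> 0 \<le> Re (\<kappa> x) \<and> 0 \<le> Im (\<kappa> x)"
    and kappa_sign_surface: "x \<in> frontier \<Omega> \<Longrightarrow> 0 \<le> Re (\<kappa> x)"
begin

text \<open>The \<open>\<mu>\<close>-term of \<open>a(u,u)\<close> is real, \<open>Im \<kappa>\<^sup>2 = 2 Re \<kappa> Im \<kappa> \<ge> 0\<close>, and the boundary term
  contributes \<open>- Re \<kappa> \<bar>u\<bar>\<^sup>2\<close>: the medium and the boundary absorb energy.\<close>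

lemma Im_form_a_le:
  assumes "u \<in> V" shows "Im (a u u) \<le> 0"
proof -
  have vol: "Im (\<integral>x. volume_integrand u u x \<partial>lebesgue_on (D j)) \<le> 0" for j
  proof -
    have "Im (volume_integrand u u x) \<le> 0" if "x \<in> D j" for x
    proof -
      have "volume_integrand u u x
          = of_real (\<mu> x * (\<Sum>i\<in>UNIV. (cmod (partial_deriv i u x))\<^sup>2)) - (\<kappa> x)\<^sup>2 * of_real ((cmod (u x))\<^sup>2)"
        unfolding volume_integrand_def by (simp only: of_real_mult of_real_sum complex_norm_square mult.assoc)
      then have "Im (volume_integrand u u x) = - (2 * Re (\<kappa> x) * Im (\<kappa> x)) * (cmod (u x))\<^sup>2"
        by (simp add: power2_eq_square)
      moreover have "0 \<le> Re (\<kappa> x)" "0 \<le> Im (\<kappa> x)" using kappa_sign_volume D_subset that by blast+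
      ultimately show ?thesis by simp
    qed
    then have "0 \<le> (\<integral>x. - Im (volume_integrand u u x) \<partial>lebesgue_on (D j))"
      by (intro integral_nonneg_AE AE_I2) auto
    then show ?thesis using volume_integrable[OF assms assms] by simp
  qed
  have surf: "0 \<le> Re (\<integral>x. surface_integrand j u u x \<partial>restrict_space \<sigma> (\<Gamma> j))" for j
  proof -
    have "0 \<le> Re (surface_integrand j u u x)" if "x \<in> \<Gamma> j" for x
    proof -
      have "surface_integrand j u u x = \<kappa> x * of_real ((cmod (trace_from (D j) u x))\<^sup>2)"
        unfolding surface_integrand_def by (simp only: complex_norm_square mult.assoc)
      then show ?thesis using kappa_sign_surface[of x] that by simp
    qed
    then have "0 \<le> (\<integral>x. Re (surface_integrand j u u x) \<partial>restrict_space \<sigma> (\<Gamma> j))"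
      by (intro integral_nonneg_AE AE_I2) (auto simp: space_restrict_space)
    then show ?thesis using surface_integrable[OF assms assms] by simp
  qed
  show ?thesis unfolding form_a_eq using order_trans[OF vol surf] by (auto intro!: sum_nonpos)
qed

end

context decomposed_mesh begin

text \<open>Square integrable functions are integrable here because both measures are finite, and test
  functions are bounded.\<close>

lemma form_l_antilinear:
  assumes f: "L2_fun (lebesgue_on \<Omega>) f" and g: "L2_fun (restrict_space (surface_measure \<Omega> \<T>) (frontier \<Omega>)) g"
  shows "antilinear_on V (form_l \<Omega> \<T> D f g)"
proof -
  have "finite_measure (lebesgue_on \<Omega>)"
    using lmeasurable_open[OF bounded_\<Omega> open_\<Omega>] by (rule finite_measure_lebesgue_on)
  then have "integrable (lebesgue_on \<Omega>) f" by (rule L2_fun_integrable[OF f])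
  then have fD: "integrable (lebesgue_on (D j)) f" for j
    unfolding restrict_D(1) using restrict_D(2)[of j] D_subset[of j] sets.sets_into_space[OF restrict_D(2)]
    by (subst integrable_restrict_space) (auto simp: Int_absorb2 intro: integrable_mult_indicator)
  have "finite_measure (restrict_space \<sigma> (frontier \<Omega>))"
    using finite_measure_restrict_space[OF finite_surface_measure frontier_sets] .
  then have "integrable (restrict_space \<sigma> (frontier \<Omega>)) g" by (rule L2_fun_integrable[OF g])
  then have gD: "integrable (restrict_space \<sigma> (\<Gamma> j)) g" for j
    unfolding restrict_\<Gamma>(1) using restrict_\<Gamma>(2)[of j] sets.sets_into_space[OF restrict_\<Gamma>(2)]
    by (subst integrable_restrict_space) (auto simp: Int_absorb2 intro: integrable_mult_indicator)
  have vol: "integrable (lebesgue_on (D j)) (\<lambda>x. f x * cnj (v x))" if "v \<in> V" for v j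
    by (intro integrable_mult_bounded_measurable[OF fD] bounded_measurable_cnj broken_bounded_measurable that)
  have surf: "integrable (restrict_space \<sigma> (\<Gamma> j)) (\<lambda>x. g x * cnj (trace_from (D j) v x))" if "v \<in> V" for v j
    by (intro integrable_mult_bounded_measurable[OF gD] bounded_measurable_cnj trace_bounded_measurable that)
  have "form_l \<Omega> \<T> D f g (u + v) = form_l \<Omega> \<T> D f g u + form_l \<Omega> \<T> D f g v" if "u \<in> V" "v \<in> V" for u v
  proof -
    have "(\<integral>x. f x * cnj ((u + v) x) \<partial>lebesgue_on (D j))
      = (\<integral>x. f x * cnj (u x) \<partial>lebesgue_on (D j)) + (\<integral>x. f x * cnj (v x) \<partial>lebesgue_on (D j))" for j
      using vol[OF that(1), of j] vol[OF that(2), of j] by (simp add: distrib_left)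
    moreover have "(\<integral>x. g x * cnj (trace_from (D j) (u + v) x) \<partial>restrict_space \<sigma> (\<Gamma> j))
      = (\<integral>x. g x * cnj (trace_from (D j) u x) + g x * cnj (trace_from (D j) v x) \<partial>restrict_space \<sigma> (\<Gamma> j))" for j
      using that by (intro Bochner_Integration.integral_cong refl)
        (auto simp: trace_from_add space_restrict_space distrib_left)
    ultimately show ?thesis
      unfolding form_l_def set_integral_\<Gamma> using surf[OF that(1)] surf[OF that(2)] by (simp add: sum.distrib)
  qed
  moreover have "form_l \<Omega> \<T> D f g (cscale c v) = cnj c * form_l \<Omega> \<T> D f g v" if "v \<in> V" for c v
  proof -
    have "(\<integral>x. f x * cnj (cscale c v x) \<partial>lebesgue_on (D j)) = cnj c * (\<integral>x. f x * cnj (v x) \<partial>lebesgue_on (D j))" for j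
      unfolding integral_mult_right_zero[symmetric] by (simp add: cscale_def mult_ac)
    moreover have "(\<integral>x. g x * cnj (trace_from (D j) (cscale c v) x) \<partial>restrict_space \<sigma> (\<Gamma> j))
      = cnj c * (\<integral>x. g x * cnj (trace_from (D j) v x) \<partial>restrict_space \<sigma> (\<Gamma> j))" for j
      unfolding integral_mult_right_zero[symmetric]
      using that by (intro Bochner_Integration.integral_cong refl)
        (auto simp: trace_from_cscale space_restrict_space mult_ac)
    ultimately show ?thesis
      unfolding form_l_def set_integral_\<Gamma> by (simp add: sum_distrib_left distrib_left)
  qed
  ultimately show ?thesis by (simp add: antilinear_on_def)
qed

end

section \<open>Contraction of the relaxed iteration\<close>

context scalar_product_space begin

text \<open>The infimum of reals that defines \<open>\<gamma>\<^sub>h\<close> is taken over a set bounded below by \<open>0\<close> and, thanks to \<open>w\<close>,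
  nonempty; otherwise its value would be unspecified.\<close>

lemma gamma_h_le:
  assumes "w \<in> W" "w \<noteq> 0" and maps: "\<And>w. w \<in> W \<Longrightarrow> Pi_h (S w) \<in> W"
  shows "gamma_h W t Pi_h S * t_norm t w \<le> t_norm t (w + Pi_h (S w))"
    and "0 \<le> gamma_h W t Pi_h S"
proof -
  let ?q = "\<lambda>w. t_norm t (w + Pi_h (S w)) / t_norm t w"
  have nonneg: "0 \<le> ?q w" if "w \<in> W" for w
    using that maps add_closed t_norm_nonneg by simp
  then have "bdd_below (?q ` (W - {0}))" by (auto intro!: bdd_belowI2[of _ 0])
  then have "gamma_h W t Pi_h S \<le> ?q w"
    unfolding gamma_h_def using assms by (intro cINF_lower) auto
  then show "gamma_h W t Pi_h S * t_norm t w \<le> t_norm t (w + Pi_h (S w))"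
    using t_norm_pos[OF assms(1,2)] by (simp add: pos_le_divide_eq)
  show "0 \<le> gamma_h W t Pi_h S"
    unfolding gamma_h_def using assms nonneg by (intro cINF_greatest) auto
qed

text \<open>Apply the convexity identity to \<open>x = e\<^sub>n\<close> and \<open>y = \<Pi> S e\<^sub>n\<close>, with \<open>\<parallel>y\<parallel> \<le> \<parallel>x\<parallel>\<close> and \<open>\<parallel>x + y\<parallel> \<ge> \<gamma>\<^sub>h \<parallel>x\<parallel>\<close>.\<close>

lemma relaxed_iteration_decay:
  assumes maps: "\<And>w. w \<in> W \<Longrightarrow> Pi_h (S w) \<in> W"
    and nonexpansive: "\<And>w. w \<in> W \<Longrightarrow> t_norm t (Pi_h (S w)) \<le> t_norm t w"
    and r: "0 < r" "r < 1"
    and e: "\<And>n. e n \<in> W" "e 0 \<noteq> 0"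
    and step: "\<And>n. e (Suc n) = of_real (1 - r) *\<^sub>c e n - of_real r *\<^sub>c Pi_h (S (e n))"
  shows "t_norm t (e n) / t_norm t (e 0) \<le> sqrt (1 - r * (1 - r) * (gamma_h W t Pi_h S)\<^sup>2) ^ n"
proof -
  let ?\<gamma> = "gamma_h W t Pi_h S"
  let ?c = "1 - r * (1 - r) * ?\<gamma>\<^sup>2"
  have sq: "(t_norm t (e (Suc n)))\<^sup>2 \<le> ?c * (t_norm t (e n))\<^sup>2" for n
  proof -
    have "(t_norm t (Pi_h (S (e n))))\<^sup>2 \<le> (t_norm t (e n))\<^sup>2"
      using nonexpansive maps e t_norm_nonneg by (simp add: power_mono)
    then have "r * (t_norm t (Pi_h (S (e n))))\<^sup>2 \<le> r * (t_norm t (e n))\<^sup>2" using r by simp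
    moreover have "r * (1 - r) * (?\<gamma>\<^sup>2 * (t_norm t (e n))\<^sup>2) \<le> r * (1 - r) * (t_norm t (e n + Pi_h (S (e n))))\<^sup>2"
    proof (rule mult_left_mono)
      show "?\<gamma>\<^sup>2 * (t_norm t (e n))\<^sup>2 \<le> (t_norm t (e n + Pi_h (S (e n))))\<^sup>2"
      proof (cases "e n = 0")
        case True
        then show ?thesis using t_norm_sq[OF e(1), of n] t_zero[OF e(1), of n] by simp
      next
        case False
        then show ?thesis
          unfolding power_mult_distrib[symmetric]
          using gamma_h_le[where S = S and Pi_h = Pi_h, OF e(1) False maps] t_norm_nonneg[OF e(1)]
          by (intro power_mono) auto
      qed
    qed (use r in simp)
    ultimately show ?thesis
      unfolding step t_norm_sq_relaxation[OF e(1) maps[OF e(1)]] by (simp add: algebra_simps)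
  qed
  \<comment> \<open>The contraction factor is nonnegative because the initial error is nonzero; the square root of
    a negative real would be negative.\<close>
  have c: "0 \<le> ?c"
    using order_trans[OF zero_le_power2 sq[of 0]] t_norm_pos[OF e(1,2)]
    by (simp add: zero_le_mult_iff)
  have "t_norm t (e n) \<le> sqrt ?c ^ n * t_norm t (e 0)"
  proof (induction n)
    case (Suc n)
    have "t_norm t (e (Suc n)) \<le> sqrt (?c * (t_norm t (e n))\<^sup>2)"
      using sq by (rule real_le_rsqrt)
    also have "\<dots> = sqrt ?c * t_norm t (e n)"
      using t_norm_nonneg[OF e(1)] by (simp add: real_sqrt_mult)
    also have "\<dots> \<le> sqrt ?c * (sqrt ?c ^ n * t_norm t (e 0))"
      using Suc c by (intro mult_left_mono) auto
    finally show ?case by (simp add: mult_ac)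
  qed simp
  then show ?thesis using t_norm_pos[OF e(1,2)] by (simp add: pos_divide_le_eq)
qed

end

section \<open>Local impedance problems\<close>

locale impedance_problem = dissipative_form \<Omega> \<T> k D \<kappa> \<mu>
    + scalar_product_space "multi_trace_space \<Omega> \<T> k D" t
  for \<Omega> :: "(real^'n) set" and \<T> :: "(real^'n) set set" and k :: nat
    and D :: "'j::finite \<Rightarrow> (real^'n) set"
    and \<kappa> :: "real^'n \<Rightarrow> complex" and \<mu> :: "real^'n \<Rightarrow> real"
    and t :: "('j \<Rightarrow> real^'n \<Rightarrow> complex) \<Rightarrow> ('j \<Rightarrow> real^'n \<Rightarrow> complex) \<Rightarrow> complex" +
  assumes inf_sup: "alpha_h \<Omega> \<T> k D \<kappa> \<mu> > 0"
begin

abbreviation "tr \<equiv> multi_trace D"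
abbreviation "solves \<equiv> impedance_solution V D a t"
abbreviation "trace_load p \<equiv> \<lambda>v. t p (tr v)"

lemma solves_linear_combination:
  assumes "solves F u" "solves G v"
  shows "solves (\<lambda>x. F x + c * G x) (u + cscale c v)"
proof -
  have uv: "u \<in> V" "v \<in> V" using assms by (auto simp: impedance_solution_def)
  have cv: "cscale c v \<in> V" "u + cscale c v \<in> V"
    using uv subspace_broken_Vh cfun.subspace_add cfun.subspace_scale by blast+
  have "a (u + cscale c v) w - \<i> * t (tr (u + cscale c v)) (tr w) = F w + c * G w" if w: "w \<in> V" for w
  proof -
    have "a u w - \<i> * t (tr u) (tr w) = F w" "a v w - \<i> * t (tr v) (tr w) = G w"
      using assms w by (auto simp: impedance_solution_def)
    moreover have "a (u + cscale c v) w = a u w + c * a v w"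
      using uv cv w by (simp only: form_a_add_left form_a_cscale_left)
    moreover have "t (tr (u + cscale c v)) (tr w) = t (tr u) (tr w) + c * t (tr v) (tr w)"
      using uv cv w by (simp only: multi_trace_add multi_trace_cscale t_add_left t_smul_left smul_closed multi_trace_in)
    ultimately show ?thesis by (simp add: algebra_simps)
  qed
  then show ?thesis using cv by (simp add: impedance_solution_def)
qed

text \<open>Expand the square and insert the imaginary part of the local equation tested with \<open>w\<close>; the two
  multiples of \<open>\<parallel>w\<parallel>\<^sup>2\<close> cancel.\<close>

lemma energy_identity:
  assumes "p \<in> W" "solves (trace_load p) w"
  shows "(t_norm t (p + (2 * \<i>) *\<^sub>c tr w))\<^sup>2 = (t_norm t p)\<^sup>2 + 4 * Im (a w w)"
proof -
  have w: "w \<in> V" "tr w \<in> W" using assms multi_trace_in by (auto simp: impedance_solution_def)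
  have "a w w - \<i> * t (tr w) (tr w) = t p (tr w)" using assms(2) w(1) by (simp add: impedance_solution_def)
  then have "Im (t p (tr w)) = Im (a w w) - (t_norm t (tr w))\<^sup>2"
    using w(2) by (auto simp: t_norm_sq dest: arg_cong[where f = Im])
  then show ?thesis
    using t_norm_sq_add_smul[OF assms(1) w(2), of "2 * \<i>"] by (simp add: norm_mult power_mult_distrib algebra_simps)
qed

text \<open>Testing with \<open>w\<close> itself, dissipation forces \<open>\<parallel>tr w\<parallel>\<^sup>2 \<le> 0\<close>.  So \<open>w\<close> lies in \<open>V\<^sub>h\<close>, where \<open>a(w, \<cdot>) = 0\<close>
  contradicts the inf-sup condition unless \<open>w = 0\<close>.\<close>

lemma homogeneous_solution_zero:
  assumes "solves (\<lambda>v. 0) w" shows "w = 0"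
proof (rule ccontr)
  assume w0: "w \<noteq> 0"
  have w: "w \<in> V" "tr w \<in> W" using assms multi_trace_in by (auto simp: impedance_solution_def)
  have eq: "a w v = \<i> * t (tr w) (tr v)" if "v \<in> V" for v
    using assms that by (simp add: impedance_solution_def)
  have "Re (t (tr w) (tr w)) \<le> 0" using eq[OF w(1)] Im_form_a_le[OF w(1)] by simp
  then have tr0: "tr w = 0" using t_pos[OF w(2)] by fastforce
  have a0: "a w v = 0" if v: "v \<in> V0" for v
  proof -
    have "a w v = \<i> * t 0 (tr (restr (\<Union>j. D j) v))"
      using eq[OF broken_representative(1)[OF v]] form_a_broken_representative tr0 by simp
    then show ?thesis using t_zero multi_trace_in[OF broken_representative(1)[OF v]] by simp
  qed
  have wV0: "w \<in> V0 - {0}" using zero_trace_in_Vh[OF w(1) tr0] w0 by simp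
  have "alpha_h \<Omega> \<T> k D \<kappa> \<mu> \<le> (SUP v\<in>V0 - {0}. ereal (cmod (a w v) / (H1_norm \<Omega> \<kappa> w * H1_norm \<Omega> \<kappa> v)))"
    unfolding alpha_h_def by (rule INF_lower[OF wV0])
  also have "\<dots> \<le> 0" using a0 by (intro SUP_least) simp
  finally show False using inf_sup by simp
qed

lemma solution_unique:
  assumes "solves F u" "solves F v" shows "u = v"
proof -
  have "solves (\<lambda>x. 0) (u + cscale (- 1) v)"
    using solves_linear_combination[OF assms, of "- 1"] by simp
  then have "u + cscale (- 1) v = 0" by (rule homogeneous_solution_zero)
  then show ?thesis by (simp add: cscale_def fun_eq_iff)
qed

lemma trace_load_antilinear: "p \<in> W \<Longrightarrow> antilinear_on V (trace_load p)"
  by (simp add: antilinear_on_def multi_trace_add multi_trace_cscale t_add_right t_smul_right multi_trace_in)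

lemma solution_exists:
  assumes "antilinear_on V F" shows "\<exists>w. solves F w"
proof -
  obtain G where G: "finite G" "V \<subseteq> cfun.span G" using broken_Vh_finite_span by blast
  have "\<exists>w\<in>V. \<forall>v\<in>V. a w v - \<i> * t (tr w) (tr v) = F v"
  proof (rule nondegenerate_form_solvable[OF subspace_broken_Vh G])
    show "linear_functional_on V (\<lambda>u. a u v - \<i> * t (tr u) (tr v))" if v: "v \<in> V" for v
      using form_a_left[OF v] v unfolding linear_functional_on_def
      by (simp add: multi_trace_add multi_trace_cscale t_add_left t_smul_left multi_trace_in algebra_simps)
    show "antilinear_on V (\<lambda>v. a u v - \<i> * t (tr u) (tr v))" if u: "u \<in> V" for u
      using form_a_right[OF u] trace_load_antilinear[OF multi_trace_in[OF u]] unfolding antilinear_on_def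
      by (simp add: algebra_simps)
    show "u = 0" if "u \<in> V" "\<forall>v\<in>V. a u v - \<i> * t (tr u) (tr v) = 0" for u
      using that by (intro homogeneous_solution_zero) (simp add: impedance_solution_def)
  qed (rule assms)
  then show ?thesis by (auto simp: impedance_solution_def)
qed

lemma solution_eq: "solves F w \<Longrightarrow> (THE w. solves F w) = w"
  using solution_unique by blast

lemma scattering_eq: "solves (trace_load p) w \<Longrightarrow> scattering V D a t p = p + (2 * \<i>) *\<^sub>c tr w"
  unfolding scattering_def by (simp only: solution_eq)

lemma scattering_nonexpansive:
  assumes "p \<in> W"
  shows "scattering V D a t p \<in> W" "t_norm t (scattering V D a t p) \<le> t_norm t p"
proof -
  obtain w where w: "solves (trace_load p) w" using solution_exists trace_load_antilinear assms by blast
  then have wV: "w \<in> V" by (simp add: impedance_solution_def)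
  show "scattering V D a t p \<in> W"
    unfolding scattering_eq[OF w] using assms add_closed smul_closed multi_trace_in[OF wV] by blast
  have "(t_norm t (scattering V D a t p))\<^sup>2 \<le> (t_norm t p)\<^sup>2"
    unfolding scattering_eq[OF w] energy_identity[OF assms w] using Im_form_a_le[OF wV] by simp
  then show "t_norm t (scattering V D a t p) \<le> t_norm t p"
    using t_norm_nonneg[OF assms] by (rule power2_le_imp_le)
qed

text \<open>The iterate \<open>p\<close> sees the scattering of the error \<open>p - q\<close> plus a contribution independent of \<open>p\<close>.  When \<open>q\<close>
  solves the skeleton equation, the exchange operator maps that contribution to \<open>- q\<close>.\<close>

lemma local_solution_splits:
  assumes p: "p \<in> W" and q: "q \<in> W" and l: "antilinear_on V l"
    and u: "solves (\<lambda>v. t p (tr v) + l v) u"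
  shows "p + (2 * \<i>) *\<^sub>c tr u
    = scattering V D a t (p - q) + (scattering V D a t q + (2 * \<i>) *\<^sub>c tr (THE u. solves l u))"
proof -
  obtain w where w: "solves (trace_load q) w" using solution_exists trace_load_antilinear q by blast
  obtain s where s: "solves l s" using solution_exists l by blast
  obtain e where e: "solves (trace_load (p - q)) e"
    using solution_exists trace_load_antilinear diff_closed p q by blast
  have V: "w \<in> V" "s \<in> V" "e \<in> V" using w s e by (auto simp: impedance_solution_def)
  then have ws: "w + cscale 1 s \<in> V" by (simp add: cfun.subspace_add[OF subspace_broken_Vh])
  have "solves (\<lambda>v. t (p - q) (tr v) + 1 * (t q (tr v) + 1 * l v)) (e + cscale 1 (w + cscale 1 s))"
    by (intro solves_linear_combination e w s)
  then have "solves (\<lambda>v. t p (tr v) + l v) (e + cscale 1 (w + cscale 1 s))"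
    using p q multi_trace_in by (simp add: impedance_solution_def t_diff_left)
  then have "u = e + cscale 1 (w + cscale 1 s)" by (rule solution_unique[OF u])
  then have "u = e + (w + s)" by simp
  then have "tr u = tr e + (tr w + tr s)"
    using V ws by (simp add: multi_trace_add)
  then show ?thesis
    unfolding scattering_eq[OF e] scattering_eq[OF w] solution_eq[OF s]
    by (auto simp: smul_def fun_eq_iff algebra_simps)
qed

end

section \<open>The relaxed Richardson iteration\<close>

theorem theorem9p2:
  fixes \<Omega> :: "(real^'n) set" and \<T> :: "(real^'n) set set" and k :: nat
    and D :: "'j::finite \<Rightarrow> (real^'n) set"
    and \<kappa> f g :: "real^'n \<Rightarrow> complex" and \<mu> :: "real^'n \<Rightarrow> real"
    and t :: "('j \<Rightarrow> real^'n \<Rightarrow> complex) \<Rightarrow> ('j \<Rightarrow> real^'n \<Rightarrow> complex) \<Rightarrow> complex"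
    and Pi_h :: "('j \<Rightarrow> real^'n \<Rightarrow> complex) \<Rightarrow> ('j \<Rightarrow> real^'n \<Rightarrow> complex)"
    and r :: real
    and p_inf :: "'j \<Rightarrow> real^'n \<Rightarrow> complex"
    and u :: "nat \<Rightarrow> real^'n \<Rightarrow> complex" and p :: "nat \<Rightarrow> 'j \<Rightarrow> real^'n \<Rightarrow> complex"
  defines "V \<equiv> broken_Vh \<Omega> \<T> k D"
    and "W \<equiv> multi_trace_space \<Omega> \<T> k D"
    and "a \<equiv> form_a \<Omega> \<T> D \<kappa> \<mu>"
    and "l \<equiv> form_l \<Omega> \<T> D f g"
  defines "S \<equiv> scattering V D a t"
  assumes dim: "CARD('n) \<in> {1, 2, 3}"
    and domain: "polyhedral_domain \<Omega>"
    and kappa_measurable: "\<kappa> \<in> borel_measurable (lebesgue_on \<Omega>)"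
    and mu_measurable: "\<mu> \<in> borel_measurable (lebesgue_on \<Omega>)"
    and mu_pos: "\<forall>x\<in>\<Omega>. 0 < \<mu> x"
    and kappa_sign: "\<forall>x\<in>\<Omega>. 0 \<le> Re (\<kappa> x) \<and> 0 \<le> Im (\<kappa> x)"
    and kappa_bounded: "Linf_norm \<Omega> \<kappa> < \<infinity>"
    and mu_bounded: "Linf_norm \<Omega> \<mu> + Linf_norm \<Omega> (\<lambda>x. inverse (\<mu> x)) < \<infinity>"
    and kappa_boundary_measurable: "\<kappa> \<in> borel_measurable (restrict_space (surface_measure \<Omega> \<T>) (frontier \<Omega>))"
    and kappa_boundary: "\<forall>x\<in>frontier \<Omega>. 0 \<le> Re (\<kappa> x) \<and> 0 \<le> Im (\<kappa> x) \<and> cmod (\<kappa> x) \<le> kappa_inf \<Omega> \<kappa>"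
    and f_L2: "L2_fun (lebesgue_on \<Omega>) f"
    and g_L2: "L2_fun (restrict_space (surface_measure \<Omega> \<T>) (frontier \<Omega>)) g"
    and mesh: "simplicial_mesh \<Omega> \<T>"
    and degree: "1 \<le> k"
    and partition: "mesh_partition \<Omega> \<T> D"
    and inf_sup: "alpha_h \<Omega> \<T> k D \<kappa> \<mu> > 0"
    and impedance: "scalar_product_on W t"
    and Pi_maps: "\<forall>q\<in>W. Pi_h q \<in> W"
    and Pi_projector: "orthogonal_projector t W (single_trace_space \<Omega> \<T> k D) (\<lambda>q. (1/2) *\<^sub>c (q + Pi_h q))"
    and r: "0 < r" "r < 1"
    and p_inf: "p_inf \<in> W" "p_inf + Pi_h (S p_inf) = skeleton_rhs V D a t l Pi_h"
    and iterates_in: "\<forall>n. u n \<in> V \<and> p n \<in> W"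
    and local_solves: "\<forall>n. \<forall>v\<in>V. a (u n) v - \<i> * t (multi_trace D (u n)) (multi_trace D v)
                        = t (p n) (multi_trace D v) + l v"
    and relaxation: "\<forall>n\<ge>1. p n = of_real (1 - r) *\<^sub>c p (n - 1)
                        - of_real r *\<^sub>c Pi_h (p (n - 1) + (2 * \<i>) *\<^sub>c multi_trace D (u (n - 1)))"
    and p0: "p 0 \<noteq> p_inf"
  shows "\<forall>n. t_norm t (p n - p_inf) / t_norm t (p 0 - p_inf)
           \<le> sqrt (1 - r * (1 - r) * (gamma_h W t Pi_h S)\<^sup>2) ^ n"
proof -
  interpret decomposed_mesh \<Omega> \<T> k D
    using domain mesh partition by unfold_locales
  have "Linf_norm \<Omega> \<mu> < \<infinity>" using mu_bounded by auto
  then have mu: "bounded_measurable (lebesgue_on \<Omega>) \<mu>"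
    using esssup_finite_AE_bounded mu_measurable unfolding bounded_measurable_def Linf_norm_def by blast
  have kappa: "bounded_measurable (lebesgue_on \<Omega>) \<kappa>"
    using esssup_finite_AE_bounded kappa_bounded kappa_measurable
    unfolding bounded_measurable_def Linf_norm_def by blast
  have "AE x in restrict_space (surface_measure \<Omega> \<T>) (frontier \<Omega>). norm (\<kappa> x) \<le> kappa_inf \<Omega> \<kappa>"
    using kappa_boundary by (intro AE_I2) (auto simp: space_restrict_space)
  then have kappa': "bounded_measurable (restrict_space (surface_measure \<Omega> \<T>) (frontier \<Omega>)) \<kappa>"
    using kappa_boundary_measurable unfolding bounded_measurable_def by blast
  interpret impedance_problem \<Omega> \<T> k D \<kappa> \<mu> t
    using impedance kappa mu kappa' kappa_sign kappa_boundary inf_sup multi_trace_space_add multi_trace_space_smul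
    unfolding W_def by unfold_locales auto
  interpret t_reflection "multi_trace_space \<Omega> \<T> k D" t "single_trace_space \<Omega> \<T> k D" Pi_h
    using single_trace_space_subset single_trace_space_add single_trace_space_smul Pi_maps Pi_projector
    unfolding W_def by unfold_locales auto
  note S_in = scattering_nonexpansive(1)[folded W_def V_def a_def S_def]
    and S_le = scattering_nonexpansive(2)[folded W_def V_def a_def S_def]
    and splits = local_solution_splits[folded W_def V_def a_def S_def]
    and Pi_in = Pi_closed[folded W_def]
  have l: "antilinear_on V l" unfolding V_def l_def by (rule form_l_antilinear[OF f_L2 g_L2])
  define s where "s = multi_trace D (THE u. impedance_solution V D a t l u)"
  have s: "s \<in> W"
  proof -
    obtain v where v: "impedance_solution V D a t l v"
      using solution_exists[folded V_def a_def, OF l] by blast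
    then have "s = multi_trace D v" unfolding s_def using solution_eq[folded V_def a_def] by simp
    then show ?thesis using v multi_trace_in[folded V_def W_def] by (simp add: impedance_solution_def)
  qed
  \<comment> \<open>The skeleton equation, rewritten as a fixed-point property of \<open>p_inf\<close>.\<close>
  have fixed: "Pi_h (S p_inf + (2 * \<i>) *\<^sub>c s) = - p_inf"
  proof -
    have "Pi_h (S p_inf + (2 * \<i>) *\<^sub>c s) = Pi_h (S p_inf) + (2 * \<i>) *\<^sub>c Pi_h s"
      using Pi_add[folded W_def] Pi_smul[folded W_def] S_in[OF p_inf(1)] s smul_closed[folded W_def] by simp
    also have "(2 * \<i>) *\<^sub>c Pi_h s = - (p_inf + Pi_h (S p_inf))"
      unfolding p_inf(2) skeleton_rhs_def s_def by (auto simp: smul_def fun_eq_iff)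
    also have "Pi_h (S p_inf) + - (p_inf + Pi_h (S p_inf)) = - p_inf" by (auto simp: fun_eq_iff)
    finally show ?thesis .
  qed
  have step: "p (Suc n) - p_inf = of_real (1 - r) *\<^sub>c (p n - p_inf) - of_real r *\<^sub>c Pi_h (S (p n - p_inf))" for n
  proof -
    have pn: "p n \<in> W" "p n - p_inf \<in> W" using iterates_in p_inf(1) diff_closed[folded W_def] by auto
    have "impedance_solution V D a t (\<lambda>v. t (p n) (multi_trace D v) + l v) (u n)"
      using local_solves iterates_in by (simp add: impedance_solution_def)
    then have "p n + (2 * \<i>) *\<^sub>c multi_trace D (u n) = S (p n - p_inf) + (S p_inf + (2 * \<i>) *\<^sub>c s)"
      unfolding s_def by (rule splits[OF pn(1) p_inf(1) l])
    then have "Pi_h (p n + (2 * \<i>) *\<^sub>c multi_trace D (u n)) = Pi_h (S (p n - p_inf)) + - p_inf"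
      using Pi_add[folded W_def] S_in pn p_inf(1) s smul_closed[folded W_def] add_closed[folded W_def]
      by (simp add: fixed)
    then have "p (Suc n) = of_real (1 - r) *\<^sub>c p n - of_real r *\<^sub>c (Pi_h (S (p n - p_inf)) + - p_inf)"
      using relaxation[rule_format, of "Suc n"] by simp
    then show ?thesis by (auto simp: smul_def fun_eq_iff algebra_simps)
  qed
  show ?thesis
    using relaxed_iteration_decay[folded W_def, of Pi_h S r "\<lambda>n. p n - p_inf"]
      Pi_in S_in S_le Pi_isometry[folded W_def] r iterates_in p_inf(1) diff_closed[folded W_def] p0 step
    by auto
qed

end
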